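(* Let $X$ be a finite dimensional real vector space. If $\overrightarrow{\alpha}\in A$ and $a\in X/\overrightarrow{\alpha}$, then $\varkappa(u)=(\tau_{\overrightarrow{\alpha}}u)(a)$, $u\in\mathcal{E}(X)$, defines a character of $\mathcal{E}(X)$. Conversely, each character of $\mathcal{E}(X)$ is of this form for some $\overrightarrow{\alpha}\in A$ and $a\in X/\overrightarrow{\alpha}$.
   Context: Notation. $\mathbb{R}_+=\,]0,\infty[$. For a finite dimensional real vector space $E$, $\mathbb{S}_E=(E\setminus\{0\})/\mathbb{R}_+$ is the set of half-lines $\hat a=\mathbb{R}_+a$, $a\in E\setminus\{0\}$. $\mathcal{C}_{\mathrm b}^{\mathrm u}(E)$ is the $C^*$-algebra of bounded uniformly continuous complex functions on $E$. $\mathcal{C}(\overline{E})$ is the algebra of continuous functions $u:E\to\mathbb{C}$ such that $\lim_{\lambda\to+\infty}u(\lambda a)$ exists uniformly in $\hat a\in\mathbb{S}_E$ (representatives $a$ taken on a fixed unit sphere); equivalently the norm closure, in the bounded continuous functions, of those homogeneous of degree zero outside a compact set. It is a $C^*$-subalgebra of $\mathcal{C}_{\mathrm b}^{\mathrm u}(E)$. For $E=\{0\}$ it is $\mathbb{C}$. For a linear subspace $Y\subset X$, with natural map $\pi_Y:X\to X/Y$, functions $v$ on $X/Y$ are identified with the functions $v\circ\pi_Y$ on $X$. $\mathcal{E}(X)$ is the $C^*$-subalgebra of $\mathcal{C}_{\mathrm b}^{\mathrm u}(X)$ generated by $\bigcup_Y\mathcal{C}(\overline{X/Y})$, the union being over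 all linear subspaces $Y\subset X$. Applying this to $X/Y$, $\mathcal{E}(X/Y)$ is defined and is identified with a $C^*$-subalgebra of $\mathcal{E}(X)$ (the one generated by $\bigcup_{Z\supset Y}\mathcal{C}(\overline{X/Z})$); $\mathcal{E}(0)=\mathbb{C}$. For $\alpha=\hat a\in\mathbb{S}_X$ let $[\alpha]=\mathbb{R}\alpha=\mathbb{R}a$ be the line generated by $\alpha$ and $X/\alpha:=X/[\alpha]$. For $u\in\mathcal{E}(X)$ the limit $\tau_\alpha(u)(x)=\lim_{r\to+\infty}u(ra+x)$ exists for all $x\in X$, and $\tau_\alpha$ is an endomorphism of $\mathcal{E}(X)$ and a linear projection of $\mathcal{E}(X)$ onto $\mathcal{E}(X/\alpha)$; so $\tau_\alpha(u)$ may be viewed as a function on $X/\alpha$. $A$ is the set of all finite families $\overrightarrow{\alpha}=(\alpha_1,\dots,\alpha_n)$ with $0\le n\le\dim X$, $\alpha_1\in\mathbb{S}_X$, $\alpha_2\in\mathbb{S}_{X/\alpha_1}$, $\alpha_3\in\mathbb{S}_{X/[\alpha_1,\alpha_2]}$, and so on. Here $[\alpha_1,\dots,\alpha_k]$ is the $k$-dimensional subspace of $X$ defined inductively as the inverse image, under $X\to X/[\alpha_1,\dots,\alpha_{k-1}]$, of the line $\mathbb{R}\alpha_k$, and $(X/[\alpha_1,\dots,\alpha_{k-1}])/\alpha_k$ is identified with $X/[\alpha_1,\dots,\alpha_k]$. One sets $X/\overrightarrow{\alpha}=X/[\alpha_1,\dots,\alpha_n]$ and $\tau_{\overrightarrow{\alpha}}=\tau_{\alpha_n}\cdots\tau_{\alpha_1}:\mathcal{E}(X)\to\mathcal{E}(X/\overrightarrow{\alpha})$,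 where $\tau_{\alpha_k}$ is the morphism $\mathcal{E}(X/[\alpha_1,\dots,\alpha_{k-1}])\to\mathcal{E}(X/[\alpha_1,\dots,\alpha_k])$ defined by $\tau_{\alpha_k}(u)(x)=\lim_{r\to+\infty}u(ra_k+x)$ for $u\in\mathcal{E}(X/[\alpha_1,\dots,\alpha_{k-1}])$ and $x\in X/[\alpha_1,\dots,\alpha_{k-1}]$, with $a_k\in X/[\alpha_1,\dots,\alpha_{k-1}]$ any nonzero vector such that $\alpha_k=\mathbb{R}_+a_k$ (the limit exists, and the resulting function is viewed as a function on $X/[\alpha_1,\dots,\alpha_k]$). For $n=0$, $X/\overrightarrow{\alpha}=X$ and $\tau_{\overrightarrow{\alpha}}$ is the identity. $\tau_{\overrightarrow{\alpha}}u$ is regarded as a function on $X/\overrightarrow{\alpha}$. A character of a commutative $C^*$-algebra is a nonzero $*$-morphism to $\mathbb{C}$. *)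

theory Defs
  imports "HOL-Analysis.Analysis"
begin

text \<open>
  The finite dimensional space \<open>X\<close> is a type of class \<^class>\<open>real_normed_vector\<close> (which, unlike
  \<^class>\<open>euclidean_space\<close>, admits dimension zero); finite dimensionality is an explicit hypothesis
  of the theorem. The norm only serves to describe the canonical topology and uniform structure
  and to fix the unit spheres. For a subspace \<open>Y\<close>, the points of \<open>X / Y\<close> are cosets, and a function
  \<open>v\<close> on \<open>X / Y\<close> is identified with \<open>v \<circ> \<pi>\<^sub>Y\<close>, so that all the algebras consist of functions on \<open>X\<close>.
\<close>

definition quot_proj :: "'a::real_normed_vector set \<Rightarrow> 'a \<Rightarrow> 'a set" where
  "quot_proj Y x = (\<lambda>y. x + y) ` Y"

definition quot_space :: "'a::real_normed_vector set \<Rightarrow> 'a set set" where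
  "quot_space Y = range (quot_proj Y)"

text \<open>
  The value at the point \<open>c\<close> of \<open>X / Y\<close> of the function on \<open>X / Y\<close> identified with \<open>f\<close>; meaningful
  if \<open>f\<close> is constant on \<open>c\<close>.
\<close>
definition quot_eval :: "('a \<Rightarrow> complex) \<Rightarrow> 'a set \<Rightarrow> complex" where
  "quot_eval f c = the_elem (f ` c)"

definition bdd_ucont :: "('a::real_normed_vector \<Rightarrow> complex) set" where
  "bdd_ucont = {u. bounded (range u) \<and> uniformly_continuous_on UNIV u}"

definition cstar_subalgebra :: "('a::real_normed_vector \<Rightarrow> complex) set \<Rightarrow> bool" where
  "cstar_subalgebra S \<longleftrightarrow>
     S \<subseteq> bdd_ucont \<and>
     (\<lambda>x. 0) \<in> S \<and>
     (\<forall>u\<in>S. \<forall>v\<in>S. (\<lambda>x. u x + v x) \<in> S) \<and>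
     (\<forall>c. \<forall>u\<in>S. (\<lambda>x. c * u x) \<in> S) \<and>
     (\<forall>u\<in>S. \<forall>v\<in>S. (\<lambda>x. u x * v x) \<in> S) \<and>
     (\<forall>u\<in>S. (\<lambda>x. cnj (u x)) \<in> S) \<and>
     (\<forall>f u. (\<forall>n. f n \<in> S) \<and> uniform_limit UNIV f u sequentially \<longrightarrow> u \<in> S)"

text \<open>
  \<open>radial_algebra Y\<close> is the algebra of continuous functions on the spherical compactification of
  \<open>X / Y\<close>. A function on \<open>X / Y\<close> is continuous iff its composition with \<open>\<pi>\<^sub>Y\<close> is. Since \<open>infdist a Y\<close>
  is the quotient norm of \<open>\<pi>\<^sub>Y a\<close>, the set \<open>{a. infdist a Y = 1}\<close> is the preimage of the unit sphere
  of \<open>X / Y\<close>; it is empty for \<open>Y = X\<close>.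
\<close>
definition radial_algebra :: "'a::real_normed_vector set \<Rightarrow> ('a \<Rightarrow> complex) set" where
  "radial_algebra Y =
     {v \<circ> quot_proj Y | v. continuous_on UNIV (v \<circ> quot_proj Y) \<and>
        (\<exists>l. uniform_limit {a. infdist a Y = 1} (\<lambda>(r::real) a. v (quot_proj Y (r *\<^sub>R a))) l at_top)}"

text \<open>The \<open>C\<^sup>*\<close>-algebra \<open>\<E>(X)\<close>:\<close>
definition asymp_algebra :: "('a::real_normed_vector \<Rightarrow> complex) set" where
  "asymp_algebra = cstar_subalgebra hull (\<Union>Y\<in>{Y. subspace Y}. radial_algebra Y)"

definition half_line :: "'a::real_normed_vector set \<Rightarrow> 'a \<Rightarrow> 'a set set" where
  "half_line Y a = {quot_proj Y (r *\<^sub>R a) | r. r > 0}"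

text \<open>The set of half-lines of \<open>X / Y\<close>; here \<open>a \<notin> Y\<close> says \<open>\<pi>\<^sub>Y a \<noteq> 0\<close>:\<close>
definition sphere_at_inf :: "'a::real_normed_vector set \<Rightarrow> 'a set set set" where
  "sphere_at_inf Y = {half_line Y a | a. a \<notin> Y}"

text \<open>The inverse image under \<open>\<pi>\<^sub>Y\<close> of the line \<open>\<real>\<alpha>\<close> generated by the half-line \<open>\<alpha>\<close> of \<open>X / Y\<close>:\<close>
definition line_preimage :: "'a::real_normed_vector set \<Rightarrow> 'a set set \<Rightarrow> 'a set" where
  "line_preimage Y \<alpha> =
     {x. \<exists>a t. quot_proj Y a \<in> \<alpha> \<and> quot_proj Y x = quot_proj Y (t *\<^sub>R a)}"

text \<open>
  The morphism \<open>\<tau>\<^sub>\<alpha>\<close> for a half-line \<open>\<alpha>\<close> of \<open>X / Y\<close>; for \<open>u\<close> in \<open>\<E>(X / Y)\<close> the limit exists and does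
  not depend on the chosen vector.
\<close>
definition tau :: "'a::real_normed_vector set \<Rightarrow> 'a set set \<Rightarrow> ('a \<Rightarrow> complex) \<Rightarrow> 'a \<Rightarrow> complex" where
  "tau Y \<alpha> u x =
     (let a = (SOME a. quot_proj Y a \<in> \<alpha>) in Lim at_top (\<lambda>r::real. u (r *\<^sub>R a + x)))"

text \<open>
  In the following recursions \<open>Y\<close> is the subspace spanned by the half-lines already processed;
  they start with \<open>Y = {0}\<close>.
\<close>

fun is_family_from :: "'a::real_normed_vector set \<Rightarrow> 'a set set list \<Rightarrow> bool" where
  "is_family_from Y [] \<longleftrightarrow> True"
| "is_family_from Y (\<alpha> # \<alpha>s) \<longleftrightarrow>
     \<alpha> \<in> sphere_at_inf Y \<and> is_family_from (line_preimage Y \<alpha>) \<alpha>s"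

fun bracket_from :: "'a::real_normed_vector set \<Rightarrow> 'a set set list \<Rightarrow> 'a set" where
  "bracket_from Y [] = Y"
| "bracket_from Y (\<alpha> # \<alpha>s) = bracket_from (line_preimage Y \<alpha>) \<alpha>s"

fun tau_from ::
  "'a::real_normed_vector set \<Rightarrow> 'a set set list \<Rightarrow> ('a \<Rightarrow> complex) \<Rightarrow> 'a \<Rightarrow> complex" where
  "tau_from Y [] u = u"
| "tau_from Y (\<alpha> # \<alpha>s) u = tau_from (line_preimage Y \<alpha>) \<alpha>s (tau Y \<alpha> u)"

definition families :: "'a::real_normed_vector set set list set" where
  "families = {\<alpha>s. length \<alpha>s \<le> dim (UNIV :: 'a set) \<and> is_family_from {0} \<alpha>s}"

definition bracket :: "'a::real_normed_vector set set list \<Rightarrow> 'a set" where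
  "bracket = bracket_from {0}"

definition tau_family :: "'a::real_normed_vector set set list \<Rightarrow> ('a \<Rightarrow> complex) \<Rightarrow> 'a \<Rightarrow> complex" where
  "tau_family = tau_from {0}"

definition character_on :: "('a \<Rightarrow> complex) set \<Rightarrow> (('a \<Rightarrow> complex) \<Rightarrow> complex) \<Rightarrow> bool" where
  "character_on S \<phi> \<longleftrightarrow>
     (\<forall>u\<in>S. \<forall>v\<in>S. \<phi> (\<lambda>x. u x + v x) = \<phi> u + \<phi> v) \<and>
     (\<forall>c. \<forall>u\<in>S. \<phi> (\<lambda>x. c * u x) = c * \<phi> u) \<and>
     (\<forall>u\<in>S. \<forall>v\<in>S. \<phi> (\<lambda>x. u x * v x) = \<phi> u * \<phi> v) \<and>
     (\<forall>u\<in>S. \<phi> (\<lambda>x. cnj (u x)) = cnj (\<phi> u)) \<and>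
     (\<exists>u\<in>S. \<phi> u \<noteq> 0)"

end

theory Submission
  imports Defs
begin

text \<open>
  A character of \<open>\<E>(X)\<close> is a limit of point evaluations along some filter on \<open>X\<close>, and after
  refinement such a filter moves to infinity in finitely many stages, each in a definite direction.

  Write \<open>\<E>\<^sub>Y\<close> for the copy of \<open>\<E>(X / Y)\<close> inside \<open>\<E>(X)\<close>, generated by the radial functions of the
  \<open>X / Z\<close> with \<open>Z \<supseteq> Y\<close>. Two kinds of filters on \<open>X\<close> describe the spherical compactification of
  \<open>X / Y\<close>: the neighbourhoods of the coset \<open>a + Y\<close>, and, for \<open>a \<notin> Y\<close>, the truncated open cones around the
  direction of \<open>a\<close> modulo \<open>Y\<close>. Compactness of balls gives \<open>filter_refinement_in_quotient\<close>: every proper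
  filter has a proper refinement below one filter of these two kinds.

  The central fact (\<open>asymptotic_part_exists\<close>) is that along the cones around \<open>a\<close> each \<open>u \<in> \<E>\<^sub>Y\<close> is
  asymptotic to an element \<open>v\<close> of \<open>\<E>\<^sub>Y\<^sub>'\<close>, where \<open>Y' = Y + \<real>a\<close>. For a radial function of \<open>X / Z\<close> this is
  clear: if \<open>a \<in> Z\<close>, it belongs to \<open>\<E>\<^sub>Y\<^sub>'\<close> itself, and if \<open>a \<notin> Z\<close>, it tends to a constant, because a
  cone modulo \<open>Y\<close> lies in a cone modulo \<open>Z\<close>. The property survives sums, products, conjugates and
  uniform limits. The rays \<open>r \<mapsto> r a + x\<close> run into all these cones and \<open>v\<close> is constant on them, so
  \<open>v = \<tau>\<^sub>\<alpha> u\<close>; in particular \<open>v\<close> is unique, whence \<open>\<tau>\<^sub>\<alpha>\<close> is a morphism. Composing morphisms with an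
  evaluation proves that the functionals of the theorem are characters.

  Conversely, a character is the limit of the evaluations along some proper filter
  (\<open>character_limit_of_evaluations\<close>): otherwise finitely many \<open>|u - \<phi>(u)|\<^sup>2\<close> would have a sum in the
  kernel of \<open>\<phi>\<close> that is bounded away from zero, hence invertible. Refine this filter modulo \<open>{0}\<close>. If it
  approaches a point, the evaluation there is the character. If it enters the cones around \<open>a\<close>, then
  \<open>u\<close> and \<open>\<tau>\<^sub>\<alpha> u\<close> have the same limit, and the argument is repeated modulo \<open>\<real>a\<close>; it ends
  because the dimension of the quotient drops each time.
\<close>

section \<open>Finite dimensional normed spaces\<close>

text \<open>
  Induction on the spanning set: a new direction \<open>b\<close> has positive distance from the span of the
  others, which the induction hypothesis makes closed, so the coefficients of \<open>b\<close> along a bounded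
  sequence are bounded, and successive subsequences of both parts converge.
\<close>
lemma bounded_sequence_in_finite_span:
  fixes B :: "'a::real_normed_vector set"
  assumes "finite B" "bounded (range x)" "range x \<subseteq> span B"
  shows "\<exists>l\<in>span B. \<exists>r. strict_mono (r::nat \<Rightarrow> nat) \<and> (x \<circ> r) \<longlonglongrightarrow> l"
  using assms
proof (induction B arbitrary: x rule: finite_induct)
  case empty
  then have "x = (\<lambda>n. 0)" by auto
  then show ?case
    by (intro bexI[of _ 0] exI[of _ id]) (auto simp: strict_mono_def o_def)
next
  case (insert b B)
  show ?case
  proof (cases "b \<in> span B")
    case True
    then show ?thesis using insert by (simp add: span_redundant)
  next
    case False
    have cl: "closed (span B)"
      unfolding closed_sequential_limits
    proof safe
      fix y l assume y: "\<forall>n. y n \<in> span B" "y \<longlonglongrightarrow> l"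
      then obtain l' r where "l' \<in> span B" "strict_mono (r::nat \<Rightarrow> nat)" "(y \<circ> r) \<longlonglongrightarrow> l'"
        using insert.IH[OF convergent_imp_bounded[OF y(2)]] y(1) by blast
      then show "l \<in> span B"
        using y(2) LIMSEQ_subseq_LIMSEQ LIMSEQ_unique by blast
    qed
    define d where "d = infdist b (span B)"
    have d: "d > 0"
      unfolding d_def using cl False span_zero[of B] by (intro infdist_pos_not_in_closed) auto
    have "\<exists>t. x n - t *\<^sub>R b \<in> span B" for n
      using insert.prems(2) by (auto simp: span_insert)
    then obtain t where t: "\<And>n. x n - t n *\<^sub>R b \<in> span B" by metis
    have tle: "\<bar>t n\<bar> * d \<le> norm (x n)" for n
    proof (cases "t n = 0")
      case False
      \<comment> \<open>\<open>x n / t n = b - z\<close> with \<open>z\<close> in the span of \<open>B\<close>\<close>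
    let ?z = "- (1 / t n) *\<^sub>R (x n - t n *\<^sub>R b)"
      have "d \<le> dist b ?z"
        unfolding d_def by (intro infdist_le span_scale t)
      also have "b - ?z = (1 / t n) *\<^sub>R x n"
        using False by (simp add: algebra_simps)
      then have "dist b ?z = norm (x n) / \<bar>t n\<bar>"
        by (simp add: dist_norm)
      finally show ?thesis using False by (simp add: field_simps)
    qed auto
    obtain M where M: "\<And>n. norm (x n) \<le> M"
      using insert.prems(1) by (auto simp: bounded_iff)
    have tb: "\<bar>t n\<bar> \<le> M / d" for n
      using tle[of n] M[of n] d by (simp add: field_simps)
    define y where "y n = x n - t n *\<^sub>R b" for n
    have "norm (y n) \<le> M + M / d * norm b" for n
      unfolding y_def
      using norm_triangle_ineq4[of "x n" "t n *\<^sub>R b"] M[of n] mult_right_mono[OF tb[of n] norm_ge_zero[of b]]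
      by simp
    then have "bounded (range y)" by (auto simp: bounded_iff)
    moreover have "range y \<subseteq> span B"
      using t by (auto simp: y_def)
    ultimately obtain l r where l: "l \<in> span B" "strict_mono (r::nat \<Rightarrow> nat)" "(y \<circ> r) \<longlonglongrightarrow> l"
      using insert.IH by blast
    have "bounded (range (t \<circ> r))"
      using tb by (auto simp: bounded_iff)
    then obtain s q where s: "strict_mono (q::nat \<Rightarrow> nat)" "((t \<circ> r) \<circ> q) \<longlonglongrightarrow> s"
      using bounded_imp_convergent_subsequence by blast
    have "((y \<circ> r) \<circ> q) \<longlonglongrightarrow> l"
      using l s LIMSEQ_subseq_LIMSEQ by blast
    then have "(\<lambda>n. y (r (q n)) + t (r (q n)) *\<^sub>R b) \<longlonglongrightarrow> l + s *\<^sub>R b"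
      using s(2) by (intro tendsto_intros) (auto simp: o_def)
    then have "(x \<circ> (r \<circ> q)) \<longlonglongrightarrow> l + s *\<^sub>R b"
      by (simp add: y_def o_def)
    moreover have "l + s *\<^sub>R b \<in> span (insert b B)"
      using l(1) by (auto simp: span_insert intro!: exI[of _ s])
    moreover have "strict_mono (r \<circ> q)"
      using l s by (simp add: strict_mono_o)
    ultimately show ?thesis by blast
  qed
qed

lemma dim_span_insert_new:
  fixes Y :: "'a::real_normed_vector set"
  assumes fin: "finite B" "span B = (UNIV :: 'a set)" and Y: "subspace Y" and a: "a \<notin> Y"
  shows "dim (span (insert a Y)) = Suc (dim Y)"
proof -
  obtain C where C: "C \<subseteq> Y" "independent C" "Y \<subseteq> span C" "card C = dim Y"
    using basis_exists by blast
  have sC: "span C = Y"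
    using C Y by (simp add: span_subspace)
  have fC: "finite C"
    using independent_span_bound[OF fin(1) C(2)] fin by auto
  have "independent (insert a C)"
    using C(2) a sC by (simp add: independent_insertI)
  moreover have "span (insert a C) = span (insert a Y)"
    unfolding span_insert sC using Y by (simp add: span_eq_iff[THEN iffD2])
  moreover have "card (insert a C) = Suc (dim Y)"
    using fC a C by (subst card_insert_disjoint) auto
  ultimately show ?thesis
    using dim_eq_card_independent[of "insert a C"] dim_span[of "insert a C"] dim_span[of "insert a Y"]
    by simp
qed

lemma dim_le_dim_UNIV:
  fixes Y :: "'a::real_normed_vector set"
  assumes fin: "finite B" "span B = (UNIV :: 'a set)"
  shows "dim Y \<le> dim (UNIV :: 'a set)"
proof -
  obtain C where C: "C \<subseteq> Y" "independent C" "Y \<subseteq> span C" "card C = dim Y"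
    using basis_exists by blast
  obtain D where D: "D \<subseteq> (UNIV :: 'a set)" "independent D" "UNIV \<subseteq> span D" "card D = dim (UNIV :: 'a set)"
    using basis_exists by blast
  have "finite D"
    using independent_span_bound[OF fin(1) D(2)] fin by auto
  then show ?thesis
    using independent_span_bound[of D C] C D by auto
qed

context
  assumes fin: "\<exists>B :: 'a::real_normed_vector set. finite B \<and> span B = UNIV"
begin

lemma compact_cball_finite_dim: "compact (cball (0::'a) r)"
proof -
  obtain B :: "'a set" where B: "finite B" "span B = UNIV" using fin by blast
  show ?thesis
    unfolding compact_def
  proof safe
    fix x :: "nat \<Rightarrow> 'a" assume x: "\<forall>n. x n \<in> cball 0 r"
    then have "bounded (range x)" by (auto simp: bounded_iff)
    then obtain l q where l: "strict_mono (q::nat \<Rightarrow> nat)" "(x \<circ> q) \<longlonglongrightarrow> l"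
      using bounded_sequence_in_finite_span[OF B(1), of x] B by auto
    have "l \<in> cball 0 r"
      by (rule closed_sequentially[OF closed_cball _ l(2)]) (use x in simp)
    then show "\<exists>l\<in>cball 0 r. \<exists>q. strict_mono q \<and> (x \<circ> q) \<longlonglongrightarrow> l"
      using l by blast
  qed
qed

lemma closed_subspace_finite_dim:
  fixes Y :: "'a set"
  assumes "subspace Y"
  shows "closed Y"
proof -
  obtain B :: "'a set" where B: "finite B" "span B = UNIV" using fin by blast
  obtain C where C: "C \<subseteq> Y" "independent C" "Y \<subseteq> span C" "card C = dim Y"
    using basis_exists by blast
  have sC: "span C = Y"
    using C assms by (simp add: span_subspace)
  have fC: "finite C"
    using independent_span_bound[OF B(1) C(2)] B by auto
  show ?thesis
    unfolding closed_sequential_limits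
  proof safe
    fix y l assume y: "\<forall>n. y n \<in> Y" "y \<longlonglongrightarrow> l"
    then obtain l' r where "l' \<in> span C" "strict_mono (r::nat \<Rightarrow> nat)" "(y \<circ> r) \<longlonglongrightarrow> l'"
      using bounded_sequence_in_finite_span[OF fC, of y] convergent_imp_bounded[of y] sC by auto
    then show "l \<in> Y"
      using y(2) LIMSEQ_subseq_LIMSEQ LIMSEQ_unique sC by blast
  qed
qed

end

section \<open>The quotient norm\<close>

lemma infdist_scaleR_subspace:
  fixes Y :: "'a::real_normed_vector set"
  assumes Y: "subspace Y"
  shows "infdist (c *\<^sub>R x) Y = \<bar>c\<bar> * infdist x Y"
proof -
  have ne: "Y \<noteq> {}" using Y subspace_0 by blast
  have le: "infdist (c *\<^sub>R x) Y \<le> \<bar>c\<bar> * infdist x Y" if "c \<noteq> 0" for c x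
  proof -
    have "infdist (c *\<^sub>R x) Y / \<bar>c\<bar> \<le> dist x a" if "a \<in> Y" for a
    proof -
      have "infdist (c *\<^sub>R x) Y \<le> dist (c *\<^sub>R x) (c *\<^sub>R a)"
        using Y that by (intro infdist_le subspace_scale)
      also have "\<dots> = \<bar>c\<bar> * dist x a"
        by (simp add: dist_norm flip: scaleR_diff_right)
      finally show ?thesis using \<open>c \<noteq> 0\<close> by (simp add: field_simps)
    qed
    then have "infdist (c *\<^sub>R x) Y / \<bar>c\<bar> \<le> infdist x Y"
      unfolding infdist_notempty[OF ne, of x] using ne by (intro cINF_greatest) auto
    then show ?thesis using that by (simp add: field_simps)
  qed
  show ?thesis
  proof (cases "c = 0")
    case True
    then show ?thesis using Y by (simp add: subspace_0)
  next
    case False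
    then have "infdist x Y \<le> infdist (c *\<^sub>R x) Y / \<bar>c\<bar>"
      using le[of "1/c" "c *\<^sub>R x"] by simp
    then show ?thesis using le[OF False, of x] False by (simp add: field_simps)
  qed
qed

lemma infdist_add_subspace:
  fixes Y :: "'a::real_normed_vector set"
  assumes Y: "subspace Y"
  shows "infdist (x + y) Y \<le> infdist x Y + infdist y Y"
proof -
  have ne: "Y \<noteq> {}" using Y subspace_0 by blast
  have "infdist (x + y) Y - infdist y Y \<le> dist x a" if a: "a \<in> Y" for a
  proof -
    have "infdist (x + y) Y - dist x a \<le> dist y b" if b: "b \<in> Y" for b
    proof -
      have "infdist (x + y) Y \<le> dist (x + y) (a + b)"
        using Y a b by (intro infdist_le subspace_add)
      also have "\<dots> \<le> dist x a + dist y b" by (rule dist_triangle_add)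
      finally show ?thesis by simp
    qed
    then have "infdist (x + y) Y - dist x a \<le> infdist y Y"
      unfolding infdist_notempty[OF ne, of y] using ne by (intro cINF_greatest) auto
    then show ?thesis by simp
  qed
  then have "infdist (x + y) Y - infdist y Y \<le> infdist x Y"
    unfolding infdist_notempty[OF ne, of x] using ne by (intro cINF_greatest) auto
  then show ?thesis by simp
qed

lemma infdist_le_norm_subspace:
  "subspace Y \<Longrightarrow> infdist x Y \<le> norm (x::'a::real_normed_vector)"
  using infdist_le[of 0 Y x] subspace_0[of Y] by simp

lemma infdist_add_mem_subspace:
  fixes Y :: "'a::real_normed_vector set"
  assumes Y: "subspace Y" and z: "z \<in> Y"
  shows "infdist (x + z) Y = infdist x Y"
proof (rule antisym)
  show "infdist (x + z) Y \<le> infdist x Y"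
    using infdist_add_subspace[OF Y, of x z] z by simp
  show "infdist x Y \<le> infdist (x + z) Y"
    using infdist_add_subspace[OF Y, of "x + z" "- z"] z subspace_neg[OF Y z] by simp
qed

text \<open>
  The factor two leaves room for the infimum to be approached only; the representative is \<open>0\<close> if
  \<open>x \<in> Y\<close>.
\<close>
lemma near_representative:
  fixes Y :: "'a::real_normed_vector set"
  assumes Y: "subspace Y" "closed Y"
  obtains z where "z - x \<in> Y" "norm z \<le> 2 * infdist x Y"
proof (cases "x \<in> Y")
  case True
  then show ?thesis
    using that[of 0] subspace_neg[OF Y(1)] by simp
next
  case False
  have ne: "Y \<noteq> {}" using Y subspace_0 by blast
  have "infdist x Y < 2 * infdist x Y"
    using infdist_pos_not_in_closed[OF Y(2) ne False] by simp
  then obtain a where "a \<in> Y" "dist x a < 2 * infdist x Y"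
    unfolding infdist_notempty[OF ne, of x]
    using cINF_less_iff[OF ne, of "dist x"] by (auto intro: bdd_belowI2[of _ 0])
  then show ?thesis
    using that[of "x - a"] subspace_neg[OF Y(1)] by (simp add: dist_norm)
qed

section \<open>Neighbourhoods of cosets and of directions at infinity\<close>

text \<open>
  The filter on \<open>X\<close> pulled back from the neighbourhood filter of \<open>\<pi>\<^sub>Y a\<close> in \<open>X / Y\<close>.
\<close>
definition coset_nhds :: "'a::real_normed_vector set \<Rightarrow> 'a \<Rightarrow> 'a filter" where
  "coset_nhds Y a = filtercomap (\<lambda>x. infdist (x - a) Y) (nhds 0)"

text \<open>
  The trace on \<open>X\<close> of the neighbourhoods of the point at infinity of \<open>X / Y\<close> in the direction of
  \<open>\<pi>\<^sub>Y a\<close>: it is generated by the sets of all \<open>r b\<close> with \<open>r\<close> large and \<open>b\<close> close to \<open>a\<close> modulo \<open>Y\<close>.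
\<close>
definition cone_at_inf :: "'a::real_normed_vector set \<Rightarrow> 'a \<Rightarrow> 'a filter" where
  "cone_at_inf Y a = filtermap (\<lambda>(r, b). r *\<^sub>R b) (at_top \<times>\<^sub>F coset_nhds Y a)"

lemma eventually_coset_nhds:
  "eventually P (coset_nhds Y a) \<longleftrightarrow> (\<exists>e>0. \<forall>b. infdist (b - a) Y < e \<longrightarrow> P b)"
proof
  assume "eventually P (coset_nhds Y a)"
  then obtain Q where Q: "eventually Q (nhds (0::real))" "\<And>b. Q (infdist (b - a) Y) \<Longrightarrow> P b"
    unfolding coset_nhds_def eventually_filtercomap by blast
  from Q(1) obtain e where "e > 0" "\<And>d. dist d 0 < e \<Longrightarrow> Q d"
    unfolding eventually_nhds_metric by blast
  then show "\<exists>e>0. \<forall>b. infdist (b - a) Y < e \<longrightarrow> P b"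
    using Q(2) by (intro exI[of _ e]) (auto simp: infdist_nonneg)
next
  assume "\<exists>e>0. \<forall>b. infdist (b - a) Y < e \<longrightarrow> P b"
  then obtain e where "e > 0" "\<And>b. infdist (b - a) Y < e \<Longrightarrow> P b" by blast
  then show "eventually P (coset_nhds Y a)"
    unfolding coset_nhds_def eventually_filtercomap eventually_nhds_metric
    by (intro exI[of _ "\<lambda>d. d < e"]) (auto simp: dist_real_def intro!: exI[of _ e])
qed

lemma eventually_cone_at_inf:
  "eventually P (cone_at_inf Y a) \<longleftrightarrow>
     (\<exists>R. \<exists>e>0. \<forall>r>R. \<forall>b. infdist (b - a) Y < e \<longrightarrow> P (r *\<^sub>R b))"
proof
  assume "eventually P (cone_at_inf Y a)"
  then obtain Q S where "eventually Q (at_top::real filter)" "eventually S (coset_nhds Y a)"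
      "\<And>r b. Q r \<Longrightarrow> S b \<Longrightarrow> P (r *\<^sub>R b)"
    unfolding cone_at_inf_def eventually_filtermap eventually_prod_filter by auto
  then show "\<exists>R. \<exists>e>0. \<forall>r>R. \<forall>b. infdist (b - a) Y < e \<longrightarrow> P (r *\<^sub>R b)"
    unfolding eventually_at_top_dense eventually_coset_nhds by meson
next
  assume "\<exists>R. \<exists>e>0. \<forall>r>R. \<forall>b. infdist (b - a) Y < e \<longrightarrow> P (r *\<^sub>R b)"
  then obtain R e where Re: "e > 0" "\<And>r b. r > R \<Longrightarrow> infdist (b - a) Y < e \<Longrightarrow> P (r *\<^sub>R b)"
    by blast
  show "eventually P (cone_at_inf Y a)"
    unfolding cone_at_inf_def eventually_filtermap eventually_prod_filter
  proof (intro exI conjI allI impI)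
    show "eventually (\<lambda>r. r > R) at_top" by (rule eventually_gt_at_top)
    show "eventually (\<lambda>b. infdist (b - a) Y < e) (coset_nhds Y a)"
      unfolding eventually_coset_nhds using Re(1) by blast
  qed (use Re(2) in auto)
qed

lemma filterlim_coset_nhds_iff:
  "filterlim x (coset_nhds Y a) F \<longleftrightarrow> ((\<lambda>t. infdist (x t - a) Y) \<longlongrightarrow> 0) F"
  by (simp add: coset_nhds_def filterlim_filtercomap_iff o_def)

lemma filterlim_cone_at_inf_I:
  assumes "filterlim \<rho> at_top F" "((\<lambda>t. infdist (x t /\<^sub>R \<rho> t - a) Y) \<longlongrightarrow> 0) F"
  shows "filterlim x (cone_at_inf Y a) F"
  unfolding filterlim_iff
proof (intro allI impI)
  fix P assume "eventually P (cone_at_inf Y a)"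
  then obtain R e where e: "e > 0" and
      Re: "\<And>r b. r > R \<Longrightarrow> infdist (b - a) Y < e \<Longrightarrow> P (r *\<^sub>R b)"
    unfolding eventually_cone_at_inf by blast
  have "eventually (\<lambda>t. \<rho> t > max R 0) F"
    using assms(1) filterlim_at_top_dense by blast
  moreover have "eventually (\<lambda>t. infdist (x t /\<^sub>R \<rho> t - a) Y < e) F"
    using assms(2) e by (rule order_tendstoD)
  ultimately show "eventually (\<lambda>t. P (x t)) F"
  proof eventually_elim
    case (elim t)
    then show ?case using Re[of "\<rho> t" "x t /\<^sub>R \<rho> t"] by simp
  qed
qed

text \<open>
  Any vector \<open>a'\<close> on the half-line of \<open>a\<close> modulo \<open>Y\<close> is admitted, since the limit that defines
  \<open>\<tau>\<^sub>\<alpha>\<close> uses an arbitrary representative of the half-line.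
\<close>
lemma filterlim_ray_cone_at_inf:
  fixes Y :: "'a::real_normed_vector set"
  assumes Y: "subspace Y" and a': "a' - s *\<^sub>R a \<in> Y" and s: "s > 0"
  shows "filterlim (\<lambda>r. r *\<^sub>R a' + x) (cone_at_inf Y a) at_top"
proof (rule filterlim_cone_at_inf_I)
  show "filterlim (\<lambda>r. s * r) at_top at_top"
    using s by (intro filterlim_tendsto_pos_mult_at_top[OF tendsto_const]) (auto simp: filterlim_ident)
  have "((\<lambda>r. inverse (s * r) * infdist x Y) \<longlongrightarrow> 0 * infdist x Y) at_top"
    by (intro tendsto_mult tendsto_inverse_0_at_top tendsto_const
          filterlim_tendsto_pos_mult_at_top[OF tendsto_const s] filterlim_ident)
  then have "((\<lambda>r. inverse (s * r) * infdist x Y) \<longlongrightarrow> 0) at_top" by simp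
  moreover have "eventually (\<lambda>r. inverse (s * r) * infdist x Y =
      infdist ((r *\<^sub>R a' + x) /\<^sub>R (s * r) - a) Y) at_top"
    using eventually_gt_at_top[of 0]
  proof eventually_elim
    case (elim r)
    have "(r *\<^sub>R a' + x) /\<^sub>R (s * r) - a = x /\<^sub>R (s * r) + (a' - s *\<^sub>R a) /\<^sub>R s"
      using elim s by (simp add: algebra_simps)
    then show ?case
      using elim s infdist_add_mem_subspace[OF Y subspace_scale[OF Y a']]
      by (simp add: infdist_scaleR_subspace[OF Y])
  qed
  ultimately show "((\<lambda>r. infdist ((r *\<^sub>R a' + x) /\<^sub>R (s * r) - a) Y) \<longlongrightarrow> 0) at_top"
    by (rule Lim_transform_eventually)
qed

lemma filterlim_coset_nhds_perturb:
  fixes Y :: "'a::real_normed_vector set"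
  assumes Y: "subspace Y" and x: "filterlim x (coset_nhds Y a) F"
    and xy: "((\<lambda>t. y t - x t) \<longlongrightarrow> 0) F"
  shows "filterlim y (coset_nhds Y a) F"
  unfolding filterlim_coset_nhds_iff
proof (rule tendsto_sandwich[OF _ _ tendsto_const])
  show "((\<lambda>t. infdist (x t - a) Y + norm (y t - x t)) \<longlongrightarrow> 0) F"
    using tendsto_add[OF x[unfolded filterlim_coset_nhds_iff] tendsto_norm_zero[OF xy]] by simp
  have "infdist (y t - a) Y \<le> infdist (x t - a) Y + norm (y t - x t)" for t
    using infdist_add_subspace[OF Y, of "x t - a" "y t - x t"] infdist_le_norm_subspace[OF Y, of "y t - x t"]
    by simp
  then show "\<forall>\<^sub>F t in F. infdist (y t - a) Y \<le> infdist (x t - a) Y + norm (y t - x t)"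
    by simp
qed (simp add: infdist_nonneg)

text \<open>
  Division by a large \<open>r\<close> makes a small shift of \<open>r b\<close> an even smaller shift of \<open>b\<close>. This and
  the preceding lemma turn convergence of a function along these filters into uniform continuity.
\<close>
lemma filterlim_cone_at_inf_perturb:
  fixes Y :: "'a::real_normed_vector set"
  assumes Y: "subspace Y" and x: "filterlim x (cone_at_inf Y a) F"
    and xy: "((\<lambda>t. y t - x t) \<longlongrightarrow> 0) F"
  shows "filterlim y (cone_at_inf Y a) F"
  unfolding filterlim_iff
proof (intro allI impI)
  fix P assume "eventually P (cone_at_inf Y a)"
  then obtain R e where e: "e > 0" and
      Re: "\<And>r b. r > R \<Longrightarrow> infdist (b - a) Y < e \<Longrightarrow> P (r *\<^sub>R b)"
    unfolding eventually_cone_at_inf by blast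
  have "eventually (\<lambda>z. \<exists>r b. z = r *\<^sub>R b \<and> r > max R 1 \<and> infdist (b - a) Y < e / 2) (cone_at_inf Y a)"
    unfolding eventually_cone_at_inf
    by (rule exI[of _ "max R 1"], rule exI[of _ "e/2"]) (use e in auto)
  then have "eventually (\<lambda>t. \<exists>r b. x t = r *\<^sub>R b \<and> r > max R 1 \<and> infdist (b - a) Y < e / 2) F"
    by (rule eventually_compose_filterlim[OF _ x])
  moreover have "eventually (\<lambda>t. norm (y t - x t) < e / 2) F"
    using tendsto_norm_zero[OF xy] e by (intro order_tendstoD(2)) auto
  ultimately show "eventually (\<lambda>t. P (y t)) F"
  proof eventually_elim
    case (elim t)
    then obtain r b where rb: "x t = r *\<^sub>R b" "r > R" "r > 1" "infdist (b - a) Y < e / 2" by auto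
    let ?d = "(y t - x t) /\<^sub>R r"
    have "norm ?d = inverse r * norm (y t - x t)"
      unfolding norm_scaleR using rb(3) by simp
    also have "\<dots> \<le> 1 * norm (y t - x t)"
      using rb(3) by (intro mult_right_mono) (auto simp: inverse_le_1_iff)
    finally have "norm ?d \<le> norm (y t - x t)" by simp
    with rb(4) elim(2) have "infdist (b + ?d - a) Y < e"
      using infdist_add_subspace[OF Y, of "b - a" ?d] infdist_le_norm_subspace[OF Y, of ?d]
      by (simp add: algebra_simps)
    then have "P (r *\<^sub>R (b + ?d))" using rb(2) by (intro Re)
    moreover have "r *\<^sub>R (b + ?d) = y t" using rb by (simp add: algebra_simps)
    ultimately show ?case by simp
  qed
qed

lemma cone_at_inf_mono:
  assumes YZ: "subspace Y" "Y \<subseteq> Z"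
  shows "cone_at_inf Y a \<le> cone_at_inf Z a"
proof (rule filter_leI)
  fix P assume "eventually P (cone_at_inf Z a)"
  then obtain R e where e: "e > 0" and
      Re: "\<And>r b. r > R \<Longrightarrow> infdist (b - a) Z < e \<Longrightarrow> P (r *\<^sub>R b)"
    unfolding eventually_cone_at_inf by blast
  have "infdist (b - a) Z \<le> infdist (b - a) Y" for b
    using YZ subspace_0 by (intro infdist_mono) auto
  then show "eventually P (cone_at_inf Y a)"
    unfolding eventually_cone_at_inf using e Re by (meson order.strict_trans1)
qed

context
  assumes fin: "\<exists>B :: 'a::real_normed_vector set. finite B \<and> span B = UNIV"
begin

text \<open>
  Compactness of balls, for filters on an arbitrary index type: refine by the pullback of the
  neighbourhoods of a cluster point.
\<close>
lemma bounded_filter_refinement: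
  fixes q :: "'t \<Rightarrow> 'a"
  assumes freq: "frequently (\<lambda>t. norm (q t) \<le> M) F"
  obtains F' a where "F' \<le> F" "F' \<noteq> bot" "(q \<longlongrightarrow> a) F'" "eventually (\<lambda>t. norm (q t) \<le> M) F'"
proof -
  define F1 where "F1 = inf F (principal {t. norm (q t) \<le> M})"
  have F1: "F1 \<noteq> bot"
    using freq by (simp add: F1_def trivial_limit_def eventually_inf_principal frequently_def)
  have ev1: "eventually (\<lambda>t. norm (q t) \<le> M) F1"
    by (simp add: F1_def eventually_inf_principal)
  have "filtermap q F1 \<noteq> bot" "eventually (\<lambda>z. z \<in> cball 0 M) (filtermap q F1)"
    using F1 ev1 by (auto simp: filtermap_bot_iff eventually_filtermap)
  then obtain a where a: "inf (nhds a) (filtermap q F1) \<noteq> bot"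
    using compact_cball_finite_dim[OF fin, of M] unfolding compact_filter by blast
  define F' where "F' = inf F1 (filtercomap q (nhds a))"
  have "F' \<noteq> bot"
  proof
    assume "F' = bot"
    then have "eventually (\<lambda>_. False) F'" by simp
    then obtain Q P where QP: "eventually Q F1" "eventually P (filtercomap q (nhds a))" "\<And>t. Q t \<Longrightarrow> P t \<Longrightarrow> False"
      unfolding F'_def eventually_inf by blast
    then obtain S where S: "eventually S (nhds a)" "\<And>t. S (q t) \<Longrightarrow> P t"
      unfolding eventually_filtercomap by blast
    have "eventually (\<lambda>z. \<not> S z) (filtermap q F1)"
      unfolding eventually_filtermap using QP(1) by eventually_elim (use QP(3) S(2) in blast)
    then have "eventually (\<lambda>_. False) (inf (nhds a) (filtermap q F1))"
      unfolding eventually_inf using S(1) by blast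
    then show False using a trivial_limit_def by blast
  qed
  moreover have "(q \<longlongrightarrow> a) F'"
    unfolding F'_def by (intro filterlim_inf[THEN iffD2] filterlim_mono[OF filterlim_filtercomap]) auto
  moreover have "F' \<le> F1" "F' \<le> F" by (auto simp: F'_def F1_def le_infI1)
  moreover have "eventually (\<lambda>t. norm (q t) \<le> M) F'"
    using ev1 \<open>F' \<le> F1\<close> by (rule filter_leD[rotated])
  ultimately show ?thesis using that by blast
qed

text \<open>
  Compactness of the spherical compactification of \<open>X / Y\<close>. If the quotient norm of \<open>x\<close> is
  frequently bounded, representatives of bounded norm have a cluster point. Otherwise it tends to
  infinity, and the normalised vectors have representatives of norm at most \<open>2\<close>, which cluster at a
  point of the unit sphere of \<open>X / Y\<close>.
\<close>
lemma filter_refinement_in_quotient: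
  fixes x :: "'t \<Rightarrow> 'a"
  assumes Y: "subspace Y" and F: "F \<noteq> bot"
  obtains F' a where "F' \<le> F" "F' \<noteq> bot"
    "filterlim x (coset_nhds Y a) F' \<or> a \<notin> Y \<and> filterlim x (cone_at_inf Y a) F'"
proof -
  have cl: "closed Y" by (rule closed_subspace_finite_dim[OF fin Y])
  have "\<forall>z. \<exists>p. p - z \<in> Y \<and> norm p \<le> 2 * infdist z Y"
    using near_representative[OF Y cl] by metis
  then obtain p where p: "\<And>z. p z - z \<in> Y" "\<And>z. norm (p z) \<le> 2 * infdist z Y" by metis
  \<comment> \<open>Passing to the representative \<open>p z\<close> changes nothing modulo \<open>Y\<close>.\<close>
  have ip: "infdist (p z - a) Y = infdist (z - a) Y" for z a
    using infdist_add_mem_subspace[OF Y p(1)[of z], of "z - a"] by (simp add: algebra_simps)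
  show ?thesis
  proof (cases "\<exists>M. frequently (\<lambda>t. infdist (x t) Y \<le> M) F")
    case True
    then obtain M where "frequently (\<lambda>t. infdist (x t) Y \<le> M) F" by blast
    then have "frequently (\<lambda>t. norm (p (x t)) \<le> 2 * M) F"
      by (rule frequently_elim1) (meson p(2) order_trans mult_left_mono zero_le_numeral)
    then obtain F' a where F': "F' \<le> F" "F' \<noteq> bot" "((\<lambda>t. p (x t)) \<longlongrightarrow> a) F'"
      by (rule bounded_filter_refinement)
    have "((\<lambda>t. infdist (p (x t) - a) Y) \<longlongrightarrow> infdist (a - a) Y) F'"
      by (intro tendsto_infdist tendsto_intros F')
    then have "filterlim x (coset_nhds Y a) F'"
      using Y by (simp add: filterlim_coset_nhds_iff ip subspace_0)
    then show ?thesis using that F' by blast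
  next
    case False
    define q where "q t = p (x t /\<^sub>R infdist (x t) Y)" for t
    have N0: "eventually (\<lambda>t. infdist (x t) Y > M) F" for M
      using False by (auto simp: frequently_def not_le)
    then have N: "filterlim (\<lambda>t. infdist (x t) Y) at_top F"
      by (simp add: filterlim_at_top_dense)
    have N1: "eventually (\<lambda>t. infdist (q t) Y = 1) F"
      using N0[of 0]
      by eventually_elim (use ip[of _ 0] in \<open>simp add: q_def infdist_scaleR_subspace[OF Y]\<close>)
    have "eventually (\<lambda>t. norm (q t) \<le> 2) F"
      using N0[of 0]
    proof eventually_elim
      case (elim t)
      then show ?case
        using p(2)[of "x t /\<^sub>R infdist (x t) Y"] by (simp add: q_def infdist_scaleR_subspace[OF Y])
    qed
    then have "frequently (\<lambda>t. norm (q t) \<le> 2) F"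
      using F by (intro eventually_frequently) auto
    then obtain F' a where F': "F' \<le> F" "F' \<noteq> bot" "(q \<longlongrightarrow> a) F'"
      by (rule bounded_filter_refinement)
    have "((\<lambda>t. infdist (q t) Y) \<longlongrightarrow> infdist a Y) F'"
      by (intro tendsto_infdist F')
    moreover have "((\<lambda>t. infdist (q t) Y) \<longlongrightarrow> 1) F'"
      using filter_leD[OF F'(1) N1] by (rule tendsto_eventually)
    ultimately have "infdist a Y = 1"
      using F'(2) tendsto_unique by blast
    then have "a \<notin> Y" by auto
    moreover have "filterlim x (cone_at_inf Y a) F'"
    proof (rule filterlim_cone_at_inf_I)
      show "filterlim (\<lambda>t. infdist (x t) Y) at_top F'"
        using N F'(1) by (rule filterlim_mono[OF _ order_refl])
      have "((\<lambda>t. infdist (q t - a) Y) \<longlongrightarrow> infdist (a - a) Y) F'"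
        by (intro tendsto_infdist tendsto_intros F')
      then show "((\<lambda>t. infdist (x t /\<^sub>R infdist (x t) Y - a) Y) \<longlongrightarrow> 0) F'"
        using Y by (simp add: q_def ip subspace_0)
    qed
    ultimately show ?thesis using that F' by blast
  qed
qed

end

section \<open>Radial functions\<close>

lemma quot_proj_eq_iff:
  assumes Y: "subspace Y"
  shows "quot_proj Y x = quot_proj Y y \<longleftrightarrow> x - y \<in> Y"
proof
  assume "quot_proj Y x = quot_proj Y y"
  moreover have "x + 0 \<in> quot_proj Y x"
    unfolding quot_proj_def using subspace_0[OF Y] by blast
  ultimately obtain z where "x + 0 = y + z" "z \<in> Y"
    unfolding quot_proj_def by auto
  then show "x - y \<in> Y" by simp
next
  have sub: "quot_proj Y x \<subseteq> quot_proj Y y" if "x - y \<in> Y" for x y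
  proof
    fix w assume "w \<in> quot_proj Y x"
    then obtain z where z: "w = x + z" "z \<in> Y" by (auto simp: quot_proj_def)
    then have "w = y + (z + (x - y))" "z + (x - y) \<in> Y"
      using subspace_add[OF Y _ that] by auto
    then show "w \<in> quot_proj Y y" unfolding quot_proj_def by (rule image_eqI)
  qed
  assume "x - y \<in> Y"
  then show "quot_proj Y x = quot_proj Y y"
    using sub[of x y] sub[of y x] subspace_neg[OF Y] by fastforce
qed

text \<open>
  The functions on \<open>X\<close> that come from functions on \<open>X / Y\<close>.
\<close>
definition invariant_under :: "'a::real_normed_vector set \<Rightarrow> ('a \<Rightarrow> complex) \<Rightarrow> bool" where
  "invariant_under Y u \<longleftrightarrow> (\<forall>x y. x - y \<in> Y \<longrightarrow> u x = u y)"

lemma radial_algebraD: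
  assumes "u \<in> radial_algebra Y" "subspace Y"
  shows "continuous_on UNIV u" "invariant_under Y u"
    "\<exists>l. uniform_limit {a. infdist a Y = 1} (\<lambda>r a. u (r *\<^sub>R a)) l (at_top::real filter)"
proof -
  obtain v l where v: "u = v \<circ> quot_proj Y" "continuous_on UNIV u"
      "uniform_limit {a. infdist a Y = 1} (\<lambda>r a. v (quot_proj Y (r *\<^sub>R a))) l (at_top::real filter)"
    using assms(1) unfolding radial_algebra_def by blast
  show "continuous_on UNIV u" by fact
  show "invariant_under Y u"
    unfolding invariant_under_def v(1) o_def by (metis quot_proj_eq_iff[OF assms(2)])
  show "\<exists>l. uniform_limit {a. infdist a Y = 1} (\<lambda>r a. u (r *\<^sub>R a)) l (at_top::real filter)"
    using v(1,3) by auto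
qed

lemma const_in_radial_algebra: "(\<lambda>x. c) \<in> radial_algebra Y"
  unfolding radial_algebra_def
  by (intro CollectI exI[of _ "\<lambda>_. c"]) (auto simp: o_def intro!: exI[of _ "\<lambda>_. c"] uniform_limit_const)

lemma tendsto_infdist_coset_nhds:
  assumes Y: "subspace Y"
  shows "((\<lambda>b. infdist b Y) \<longlongrightarrow> infdist a Y) (coset_nhds Y a)"
proof (rule LIM_zero_cancel, rule Lim_null_comparison)
  show "((\<lambda>b. infdist (b - a) Y) \<longlongrightarrow> 0) (coset_nhds Y a)"
    using filterlim_coset_nhds_iff[of "\<lambda>b. b" Y a "coset_nhds Y a"] filterlim_ident by blast
  have "\<bar>infdist b Y - infdist a Y\<bar> \<le> infdist (b - a) Y" for b
    using infdist_add_subspace[OF Y, of "b - a" a] infdist_add_subspace[OF Y, of "a - b" b]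
      infdist_scaleR_subspace[OF Y, of "-1" "a - b"] by simp
  then show "\<forall>\<^sub>F b in coset_nhds Y a. norm (infdist b Y - infdist a Y) \<le> infdist (b - a) Y"
    by simp
qed

lemma filterlim_normalised_coset_nhds:
  assumes Y: "subspace Y" and a: "infdist a Y \<noteq> 0"
  shows "filterlim (\<lambda>b. b /\<^sub>R infdist b Y) (coset_nhds Y (a /\<^sub>R infdist a Y)) (coset_nhds Y a)"
  unfolding filterlim_coset_nhds_iff
proof (rule tendsto_sandwich[OF _ _ tendsto_const])
  let ?N = "\<lambda>b. infdist b Y"
  note N = tendsto_infdist_coset_nhds[OF Y, of a]
  have 1: "((\<lambda>b. ?N (b - a)) \<longlongrightarrow> 0) (coset_nhds Y a)"
    using filterlim_coset_nhds_iff[of "\<lambda>b. b" Y a "coset_nhds Y a"] filterlim_ident by blast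
  have "((\<lambda>b. \<bar>inverse (?N b)\<bar> * ?N (b - a) + \<bar>inverse (?N b) - inverse (?N a)\<bar> * ?N a) \<longlongrightarrow>
      \<bar>inverse (?N a)\<bar> * 0 + \<bar>inverse (?N a) - inverse (?N a)\<bar> * ?N a) (coset_nhds Y a)"
    by (intro tendsto_intros N a 1)
  then show "((\<lambda>b. \<bar>inverse (?N b)\<bar> * ?N (b - a) + \<bar>inverse (?N b) - inverse (?N a)\<bar> * ?N a) \<longlongrightarrow> 0)
      (coset_nhds Y a)" by simp
  have "?N (b /\<^sub>R ?N b - a /\<^sub>R ?N a) \<le>
      \<bar>inverse (?N b)\<bar> * ?N (b - a) + \<bar>inverse (?N b) - inverse (?N a)\<bar> * ?N a" for b
  proof -
    have "b /\<^sub>R ?N b - a /\<^sub>R ?N a = inverse (?N b) *\<^sub>R (b - a) + (inverse (?N b) - inverse (?N a)) *\<^sub>R a"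
      by (simp add: algebra_simps)
    then show ?thesis
      using infdist_add_subspace[OF Y] by (metis infdist_scaleR_subspace[OF Y])
  qed
  then show "\<forall>\<^sub>F b in coset_nhds Y a. ?N (b /\<^sub>R ?N b - a /\<^sub>R ?N a) \<le>
      \<bar>inverse (?N b)\<bar> * ?N (b - a) + \<bar>inverse (?N b) - inverse (?N a)\<bar> * ?N a" by simp
qed (simp add: infdist_nonneg)

context
  assumes fin: "\<exists>B :: 'a::real_normed_vector set. finite B \<and> span B = UNIV"
begin

text \<open>
  A point close to \<open>a\<close> modulo \<open>Y\<close> differs by an element of \<open>Y\<close> from a point close to \<open>a\<close> in
  norm, to which continuity applies.
\<close>
lemma invariant_tendsto_coset_nhds:
  fixes u :: "'a \<Rightarrow> complex"
  assumes Y: "subspace Y" and u: "continuous_on UNIV u" "invariant_under Y u"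
  shows "(u \<longlongrightarrow> u a) (coset_nhds Y a)"
proof (rule tendstoI)
  fix e :: real assume e: "e > 0"
  have cl: "closed Y" by (rule closed_subspace_finite_dim[OF fin Y])
  obtain d where d: "d > 0" "\<And>z. dist z a < d \<Longrightarrow> dist (u z) (u a) < e"
    using u(1) e unfolding continuous_on_iff by (metis UNIV_I)
  have "dist (u b) (u a) < e" if b: "infdist (b - a) Y < d / 2" for b
  proof -
    obtain z where z: "z - (b - a) \<in> Y" "norm z \<le> 2 * infdist (b - a) Y"
      by (rule near_representative[OF Y cl])
    have "(a + z) - b \<in> Y" using z(1) by (simp add: algebra_simps)
    then have "u (a + z) = u b" using u(2) by (auto simp: invariant_under_def)
    moreover have "dist (a + z) a < d" using z(2) b by (simp add: dist_norm)
    ultimately show ?thesis using d(2) by metis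
  qed
  then show "\<forall>\<^sub>F b in coset_nhds Y a. dist (u b) (u a) < e"
    unfolding eventually_coset_nhds using d(1) by (meson half_gt_zero)
qed

text \<open>
  The radial limit \<open>l\<close> of the definition is a function on the unit sphere, and \<open>u\<close> is uniformly close
  to \<open>l\<close> of the direction far out. It remains to see that \<open>l\<close> is continuous at the direction of \<open>a\<close>,
  which holds because at one sufficiently large radius \<open>R\<close> it is uniformly close to the continuous
  function \<open>c \<mapsto> u (R c)\<close>.
\<close>
lemma radial_tendsto_cone_at_inf:
  fixes u :: "'a \<Rightarrow> complex"
  assumes Y: "subspace Y" and u: "u \<in> radial_algebra Y" and a: "a \<notin> Y"
  shows "\<exists>L. (u \<longlongrightarrow> L) (cone_at_inf Y a)"
proof -
  let ?N = "\<lambda>b. infdist b Y"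
  let ?n = "\<lambda>b. b /\<^sub>R ?N b"
  note D = radial_algebraD[OF u Y]
  have cl: "closed Y" by (rule closed_subspace_finite_dim[OF fin Y])
  have Na: "?N a > 0"
    using a cl Y subspace_0 by (intro infdist_pos_not_in_closed) auto
  obtain l where l: "uniform_limit {a. ?N a = 1} (\<lambda>r a. u (r *\<^sub>R a)) l (at_top::real filter)"
    using D(3) by blast
  have N1: "?N (?n b) = 1" if "?N b > 0" for b
    using that by (simp add: infdist_scaleR_subspace[OF Y])
  have "(u \<longlongrightarrow> l (?n a)) (cone_at_inf Y a)"
  proof (rule tendstoI)
    fix e :: real assume e: "e > 0"
    have "eventually (\<lambda>r. \<forall>c\<in>{a. ?N a = 1}. dist (u (r *\<^sub>R c)) (l c) < e / 4) at_top"
      using l e by (intro uniform_limitD) auto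
    then obtain R where R: "\<And>r c. r \<ge> R \<Longrightarrow> ?N c = 1 \<Longrightarrow> dist (u (r *\<^sub>R c)) (l c) < e / 4"
      unfolding eventually_at_top_linorder by auto
    \<comment> \<open>Continuity of \<open>u\<close> at the single point of radius \<open>R\<close> over the direction of \<open>a\<close>\<close>
    have "continuous_on UNIV (\<lambda>c. u (R *\<^sub>R c))"
      by (intro continuous_on_compose2[OF D(1)] continuous_intros) auto
    moreover have "invariant_under Y (\<lambda>c. u (R *\<^sub>R c))"
      using D(2) subspace_scale[OF Y] unfolding invariant_under_def
      by (metis scaleR_diff_right)
    ultimately have "((\<lambda>c. u (R *\<^sub>R c)) \<longlongrightarrow> u (R *\<^sub>R ?n a)) (coset_nhds Y (?n a))"
      by (rule invariant_tendsto_coset_nhds[OF Y])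
    then have "((\<lambda>b. u (R *\<^sub>R ?n b)) \<longlongrightarrow> u (R *\<^sub>R ?n a)) (coset_nhds Y a)"
      by (rule filterlim_compose) (use filterlim_normalised_coset_nhds[OF Y, of a] Na in auto)
    then have "eventually (\<lambda>b. dist (u (R *\<^sub>R ?n b)) (u (R *\<^sub>R ?n a)) < e / 4) (coset_nhds Y a)"
      using e by (intro tendstoD) auto
    moreover have "eventually (\<lambda>b. ?N b > ?N a / 2) (coset_nhds Y a)"
      using tendsto_infdist_coset_nhds[OF Y, of a] Na by (intro order_tendstoD(1)) auto
    ultimately have "eventually (\<lambda>b. dist (u (R *\<^sub>R ?n b)) (u (R *\<^sub>R ?n a)) < e / 4 \<and> ?N b > ?N a / 2)
        (coset_nhds Y a)" by eventually_elim auto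
    then obtain d where d: "d > 0" and close: "\<And>b. ?N (b - a) < d \<Longrightarrow>
        dist (u (R *\<^sub>R ?n b)) (u (R *\<^sub>R ?n a)) < e / 4 \<and> ?N b > ?N a / 2"
      unfolding eventually_coset_nhds by blast
    \<comment> \<open>The bound on \<open>r\<close> ensures that \<open>r b\<close> has quotient norm at least \<open>R\<close>. The four quarters of \<open>e\<close> join
      \<open>u (r b)\<close>, \<open>l\<close> at \<open>b\<close>, \<open>u\<close> at radius \<open>R\<close> over \<open>b\<close>, \<open>u\<close> at radius \<open>R\<close> over \<open>a\<close>, and \<open>l\<close> at \<open>a\<close>.\<close>
    have "dist (u (r *\<^sub>R b)) (l (?n a)) < e"
      if r: "r > max 0 (2 * R / ?N a)" and b: "?N (b - a) < d" for r b
    proof -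
      have Nb: "?N b > ?N a / 2" "?N b > 0" using close[OF b] Na by auto
      have "R \<le> r * (?N a / 2)" using r Na by (simp add: field_simps)
      also have "\<dots> \<le> r * ?N b" using r Nb by (intro mult_left_mono) auto
      finally have "dist (u ((r * ?N b) *\<^sub>R ?n b)) (l (?n b)) < e / 4"
        using R N1[OF Nb(2)] by blast
      moreover have "(r * ?N b) *\<^sub>R ?n b = r *\<^sub>R b" using Nb by (simp add: mult.assoc)
      ultimately have "dist (u (r *\<^sub>R b)) (l (?n b)) < e / 4" by (simp only:)
      moreover have "dist (u (R *\<^sub>R ?n b)) (l (?n b)) < e / 4"
        using R[OF order_refl] N1[OF Nb(2)] by blast
      moreover have "dist (u (R *\<^sub>R ?n a)) (l (?n a)) < e / 4"
        using R[OF order_refl] N1[OF Na] by blast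
      moreover have "dist (u (R *\<^sub>R ?n b)) (u (R *\<^sub>R ?n a)) < e / 4"
        using close[OF b] by blast
      ultimately show ?thesis by metric
    qed
    then show "\<forall>\<^sub>F z in cone_at_inf Y a. dist (u z) (l (?n a)) < e"
      unfolding eventually_cone_at_inf using d by blast
  qed
  then show ?thesis by blast
qed

text \<open>
  Radial functions converge after refinement, with the same limit along nearby points. Sequences
  contradicting boundedness or uniform continuity are refuted by this.
\<close>
lemma radial_refinement:
  fixes u :: "'a \<Rightarrow> complex"
  assumes Y: "subspace Y" and u: "u \<in> radial_algebra Y" and F: "F \<noteq> bot"
  obtains F' L where "F' \<le> F" "F' \<noteq> bot"
    "\<And>y. ((\<lambda>t. y t - x t) \<longlongrightarrow> 0) F' \<Longrightarrow> ((\<lambda>t. u (y t)) \<longlongrightarrow> L) F'"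
proof -
  obtain F' a where F': "F' \<le> F" "F' \<noteq> bot"
      and "filterlim x (coset_nhds Y a) F' \<or> a \<notin> Y \<and> filterlim x (cone_at_inf Y a) F'"
    using filter_refinement_in_quotient[OF fin Y F, of x] by blast
  then consider "filterlim x (coset_nhds Y a) F'" | "a \<notin> Y" "filterlim x (cone_at_inf Y a) F'" by blast
  then show ?thesis
  proof cases
    case 1
    have "(u \<longlongrightarrow> u a) (coset_nhds Y a)"
      by (rule invariant_tendsto_coset_nhds[OF Y radial_algebraD(1,2)[OF u Y]])
    then show ?thesis
      using that[OF F'] filterlim_coset_nhds_perturb[OF Y 1] filterlim_compose by blast
  next
    case 2
    then obtain L where "(u \<longlongrightarrow> L) (cone_at_inf Y a)"
      using radial_tendsto_cone_at_inf[OF Y u] by blast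
    then show ?thesis
      using that[OF F'] filterlim_cone_at_inf_perturb[OF Y 2(2)] filterlim_compose by blast
  qed
qed

text \<open>
  Without this inclusion no \<open>C\<^sup>*\<close>-subalgebra would contain the generators, and the hull that defines
  \<open>\<E>(X)\<close> would be an intersection over the empty family.
\<close>
lemma radial_algebra_bdd_ucont:
  fixes Y :: "'a set"
  assumes Y: "subspace Y"
  shows "radial_algebra Y \<subseteq> bdd_ucont"
proof
  fix u :: "'a \<Rightarrow> complex" assume u: "u \<in> radial_algebra Y"
  have "bounded (range u)"
  proof (rule ccontr)
    assume "\<not> bounded (range u)"
    then have "\<forall>n. \<exists>x. norm (u x) > real n"
      unfolding bounded_iff by (metis not_le rangeE)
    then obtain x where x: "\<And>n. norm (u (x n)) > real n" by metis
    obtain F' L where F': "F' \<le> sequentially" "F' \<noteq> bot"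
        "\<And>y. ((\<lambda>t. y t - x t) \<longlongrightarrow> 0) F' \<Longrightarrow> ((\<lambda>t. u (y t)) \<longlongrightarrow> L) F'"
      using radial_refinement[OF Y u, of sequentially x] by (auto simp: trivial_limit_sequentially)
    have "((\<lambda>t. norm (u (x t))) \<longlongrightarrow> norm L) F'"
      by (intro tendsto_norm F'(3)) simp
    moreover have "filterlim (\<lambda>n. norm (u (x n))) at_top F'"
      by (rule filterlim_at_top_mono[OF filterlim_mono[OF filterlim_real_sequentially order_refl F'(1)]])
        (use x less_imp_le in \<open>blast intro: always_eventually\<close>)
    ultimately show False
      using F'(2) not_tendsto_and_filterlim_at_infinity filterlim_at_top_imp_at_infinity by blast
  qed
  moreover have "uniformly_continuous_on UNIV u"
    unfolding uniformly_continuous_on_sequentially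
  proof safe
    fix x y :: "nat \<Rightarrow> 'a"
    assume xy: "(\<lambda>n. dist (x n) (y n)) \<longlonglongrightarrow> 0"
    show "(\<lambda>n. dist (u (x n)) (u (y n))) \<longlonglongrightarrow> 0"
    proof (rule ccontr)
      assume "\<not> ?thesis"
      then obtain e where e: "e > 0" "\<not> eventually (\<lambda>n. dist (dist (u (x n)) (u (y n))) 0 < e) sequentially"
        unfolding tendsto_iff by blast
      \<comment> \<open>Restricted to the indices where the values stay apart, the sequence has no refinement along which
        \<open>u (x n)\<close> and \<open>u (y n)\<close> have a common limit.\<close>
      define F where "F = inf sequentially (principal {n. dist (u (x n)) (u (y n)) \<ge> e})"
      have "F \<noteq> bot"
        using e(2) by (simp add: F_def trivial_limit_def eventually_inf_principal not_le)
      then obtain F' L where F': "F' \<le> F" "F' \<noteq> bot"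
          "\<And>z. ((\<lambda>t. z t - x t) \<longlongrightarrow> 0) F' \<Longrightarrow> ((\<lambda>t. u (z t)) \<longlongrightarrow> L) F'"
        using radial_refinement[OF Y u, of F x] by blast
      have "(\<lambda>n. norm (y n - x n)) \<longlonglongrightarrow> 0"
        using xy by (simp add: dist_norm norm_minus_commute)
      then have "(\<lambda>n. y n - x n) \<longlonglongrightarrow> 0"
        by (rule tendsto_norm_zero_cancel)
      moreover have "F' \<le> sequentially" using F'(1) by (simp add: F_def)
      ultimately have "((\<lambda>t. y t - x t) \<longlongrightarrow> 0) F'" by (rule tendsto_mono[rotated])
      then have "((\<lambda>t. dist (u (x t)) (u (y t))) \<longlongrightarrow> dist L L) F'"
        using F'(3)[of y] F'(3)[of x] by (intro tendsto_dist) auto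
      then have "eventually (\<lambda>t. dist (u (x t)) (u (y t)) < e) F'"
        using e(1) by (intro order_tendstoD(2)) auto
      moreover have "eventually (\<lambda>t. dist (u (x t)) (u (y t)) \<ge> e) F'"
        using F'(1) by (rule filter_leD) (simp add: F_def eventually_inf_principal)
      ultimately have "eventually (\<lambda>_. False) F'" by eventually_elim auto
      then show False using F'(2) trivial_limit_def by blast
    qed
  qed
  ultimately show "u \<in> bdd_ucont" by (simp add: bdd_ucont_def)
qed

end

section \<open>The algebras of the quotients\<close>

text \<open>
  The form in which the vanishing of a difference passes to uniform limits of both terms. It serves
  for uniform continuity and for asymptotic equality along cones alike.
\<close>
lemma tendsto_diff_zero_approx:
  fixes f g :: "'t \<Rightarrow> 'b::real_normed_vector"
  assumes "\<And>e. e > 0 \<Longrightarrow> \<exists>f' g'. (\<forall>t. dist (f t) (f' t) < e) \<and> (\<forall>t. dist (g t) (g' t) < e) \<and>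
    ((\<lambda>t. f' t - g' t) \<longlongrightarrow> 0) F"
  shows "((\<lambda>t. f t - g t) \<longlongrightarrow> 0) F"
proof (rule tendstoI)
  fix e :: real assume "e > 0"
  then obtain f' g' where fg: "\<And>t. dist (f t) (f' t) < e / 3" "\<And>t. dist (g t) (g' t) < e / 3"
      "((\<lambda>t. f' t - g' t) \<longlongrightarrow> 0) F"
    using assms[of "e / 3"] by auto
  have "eventually (\<lambda>t. dist (f' t - g' t) 0 < e / 3) F"
    using fg(3) \<open>e > 0\<close> by (intro tendstoD) auto
  then show "eventually (\<lambda>t. dist (f t - g t) 0 < e) F"
  proof eventually_elim
    case (elim t)
    have "dist (f t) (g t) \<le> dist (f t) (f' t) + dist (f' t) (g' t) + dist (g t) (g' t)"
      by metric
    then show ?case using fg(1,2)[of t] elim by (simp add: dist_norm)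
  qed
qed

lemma tendsto_diff_zero_mult:
  fixes f g f' g' :: "'t \<Rightarrow> complex"
  assumes "((\<lambda>t. f t - f' t) \<longlongrightarrow> 0) F" "((\<lambda>t. g t - g' t) \<longlongrightarrow> 0) F"
    and "\<And>t. norm (g t) \<le> M" "\<And>t. norm (f' t) \<le> M'"
  shows "((\<lambda>t. f t * g t - f' t * g' t) \<longlongrightarrow> 0) F"
proof (rule Lim_null_comparison)
  have "((\<lambda>t. norm (f t - f' t) * M + M' * norm (g t - g' t)) \<longlongrightarrow> 0 * M + M' * 0) F"
    by (intro tendsto_intros tendsto_norm_zero assms)
  then show "((\<lambda>t. norm (f t - f' t) * M + M' * norm (g t - g' t)) \<longlongrightarrow> 0) F" by simp
  have "norm (f t * g t - f' t * g' t) \<le> norm (f t - f' t) * M + M' * norm (g t - g' t)" for t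
  proof -
    have "f t * g t - f' t * g' t = (f t - f' t) * g t + f' t * (g t - g' t)"
      by (simp add: algebra_simps)
    then have "norm (f t * g t - f' t * g' t) \<le> norm (f t - f' t) * norm (g t) + norm (f' t) * norm (g t - g' t)"
      by (metis norm_mult norm_triangle_ineq)
    also have "\<dots> \<le> norm (f t - f' t) * M + M' * norm (g t - g' t)"
      by (intro add_mono mult_left_mono mult_right_mono assms norm_ge_zero)
    finally show ?thesis .
  qed
  then show "\<forall>\<^sub>F t in F. norm (f t * g t - f' t * g' t) \<le> norm (f t - f' t) * M + M' * norm (g t - g' t)"
    by simp
qed

lemma bdd_ucont_iff:
  "u \<in> bdd_ucont \<longleftrightarrow> (\<exists>M. \<forall>x. norm (u x) \<le> M) \<and>
     (\<forall>x y. (\<lambda>n. dist (x n) (y n)) \<longlonglongrightarrow> 0 \<longrightarrow> (\<lambda>n. u (x n) - u (y n)) \<longlonglongrightarrow> 0)"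
  unfolding bdd_ucont_def uniformly_continuous_on_sequentially bounded_iff
  by (simp add: dist_norm tendsto_norm_zero_iff)

lemma bdd_ucont_limit:
  assumes f: "\<And>n. f n \<in> bdd_ucont" and u: "uniform_limit UNIV f u sequentially"
  shows "u \<in> bdd_ucont"
proof -
  have near: "\<exists>n. \<forall>x. dist (u x) (f n x) < e" if e: "e > 0" for e
  proof -
    have "eventually (\<lambda>n. \<forall>x\<in>UNIV. dist (f n x) (u x) < e) sequentially"
      using u e by (rule uniform_limitD)
    then show ?thesis by (auto simp: eventually_sequentially dist_commute)
  qed
  have "\<exists>M. \<forall>x. norm (u x) \<le> M"
  proof -
    obtain n where n: "\<And>x. dist (u x) (f n x) < 1" using near[of 1] by auto
    obtain M where M: "\<And>x. norm (f n x) \<le> M" using f[of n] by (auto simp: bdd_ucont_iff)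
    have "norm (u x) \<le> M + 1" for x
      using n[of x] M[of x] norm_triangle_ineq2[of "u x" "f n x"] by (simp add: dist_norm)
    then show ?thesis by blast
  qed
  moreover have "(\<lambda>n. u (x n) - u (y n)) \<longlonglongrightarrow> 0" if xy: "(\<lambda>n. dist (x n) (y n)) \<longlonglongrightarrow> 0" for x y
  proof (rule tendsto_diff_zero_approx)
    fix e :: real assume "e > 0"
    then obtain m where "\<And>x. dist (u x) (f m x) < e" using near by blast
    moreover have "(\<lambda>n. f m (x n) - f m (y n)) \<longlonglongrightarrow> 0"
      using f[of m] xy by (auto simp: bdd_ucont_iff)
    ultimately show "\<exists>f' g'. (\<forall>t. dist (u (x t)) (f' t) < e) \<and> (\<forall>t. dist (u (y t)) (g' t) < e) \<and>
        (\<lambda>t. f' t - g' t) \<longlonglongrightarrow> 0"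
      by (intro exI[of _ "\<lambda>n. f m (x n)"] exI[of _ "\<lambda>n. f m (y n)"]) auto
  qed
  ultimately show ?thesis by (auto simp: bdd_ucont_iff)
qed

lemma cstar_subalgebra_bdd_ucont: "cstar_subalgebra bdd_ucont"
  unfolding cstar_subalgebra_def
proof (intro conjI ballI allI impI)
  show "(\<lambda>x. 0) \<in> bdd_ucont" by (auto simp: bdd_ucont_iff)
next
  fix u v :: "'a \<Rightarrow> complex" assume uv: "u \<in> bdd_ucont" "v \<in> bdd_ucont"
  obtain M N where M: "\<And>x. norm (u x) \<le> M" and N: "\<And>x. norm (v x) \<le> N"
    using uv by (auto simp: bdd_ucont_iff)
  have "norm (u x + v x) \<le> M + N" for x
    using M[of x] N[of x] norm_triangle_ineq[of "u x" "v x"] by linarith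
  moreover have "(\<lambda>n. u (x n) + v (x n) - (u (y n) + v (y n))) \<longlonglongrightarrow> 0"
    if "(\<lambda>n. dist (x n) (y n)) \<longlonglongrightarrow> 0" for x y
  proof -
    have "(\<lambda>n. (u (x n) - u (y n)) + (v (x n) - v (y n))) \<longlonglongrightarrow> 0"
      using uv that by (intro tendsto_add_zero) (auto simp: bdd_ucont_iff)
    then show ?thesis by (simp add: algebra_simps)
  qed
  ultimately show "(\<lambda>x. u x + v x) \<in> bdd_ucont" by (auto simp: bdd_ucont_iff)
  have "norm (u x * v x) \<le> M * N" for x
    unfolding norm_mult using M[of x] N[of x] by (intro mult_mono) (auto intro: order_trans[OF norm_ge_zero])
  moreover have "(\<lambda>n. u (x n) * v (x n) - u (y n) * v (y n)) \<longlonglongrightarrow> 0"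
    if "(\<lambda>n. dist (x n) (y n)) \<longlonglongrightarrow> 0" for x y
    using uv that by (intro tendsto_diff_zero_mult[OF _ _ N M]) (auto simp: bdd_ucont_iff)
  ultimately show "(\<lambda>x. u x * v x) \<in> bdd_ucont" by (auto simp: bdd_ucont_iff)
next
  fix u :: "'a \<Rightarrow> complex" and c assume u: "u \<in> bdd_ucont"
  obtain M where M: "\<And>x. norm (u x) \<le> M" using u by (auto simp: bdd_ucont_iff)
  have "norm (c * u x) \<le> norm c * M" for x
    unfolding norm_mult using M[of x] by (intro mult_left_mono) auto
  moreover have "(\<lambda>n. c * u (x n) - c * u (y n)) \<longlonglongrightarrow> 0"
    if "(\<lambda>n. dist (x n) (y n)) \<longlonglongrightarrow> 0" for x y
    unfolding right_diff_distrib[symmetric]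
    using u that by (intro tendsto_mult_right_zero) (auto simp: bdd_ucont_iff)
  ultimately show "(\<lambda>x. c * u x) \<in> bdd_ucont" by (auto simp: bdd_ucont_iff)
next
  fix u :: "'a \<Rightarrow> complex" assume u: "u \<in> bdd_ucont"
  have "(\<lambda>n. cnj (u (x n)) - cnj (u (y n))) \<longlonglongrightarrow> 0"
    if "(\<lambda>n. dist (x n) (y n)) \<longlonglongrightarrow> 0" for x y
    unfolding complex_cnj_diff[symmetric]
    using u that tendsto_cnj[of "\<lambda>n. u (x n) - u (y n)" 0] by (auto simp: bdd_ucont_iff)
  then show "(\<lambda>x. cnj (u x)) \<in> bdd_ucont" using u by (auto simp: bdd_ucont_iff)
next
  fix f :: "nat \<Rightarrow> 'a \<Rightarrow> complex" and u
  assume "(\<forall>n. f n \<in> bdd_ucont) \<and> uniform_limit UNIV f u sequentially"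
  then show "u \<in> bdd_ucont" using bdd_ucont_limit by blast
qed simp

context
  fixes S :: "('a::real_normed_vector \<Rightarrow> complex) set"
  assumes S: "cstar_subalgebra S"
begin

lemma
  shows cstar_bounded: "u \<in> S \<Longrightarrow> \<exists>M. \<forall>x. norm (u x) \<le> M"
    and cstar_continuous: "u \<in> S \<Longrightarrow> continuous_on UNIV u"
    and cstar_zero: "(\<lambda>x. 0) \<in> S"
    and cstar_add: "u \<in> S \<Longrightarrow> v \<in> S \<Longrightarrow> (\<lambda>x. u x + v x) \<in> S"
    and cstar_scale: "u \<in> S \<Longrightarrow> (\<lambda>x. c * u x) \<in> S"
    and cstar_mult: "u \<in> S \<Longrightarrow> v \<in> S \<Longrightarrow> (\<lambda>x. u x * v x) \<in> S"
    and cstar_cnj: "u \<in> S \<Longrightarrow> (\<lambda>x. cnj (u x)) \<in> S"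
    and cstar_limit: "(\<And>n. f n \<in> S) \<Longrightarrow> uniform_limit UNIV f u sequentially \<Longrightarrow> u \<in> S"
proof -
  show "\<exists>M. \<forall>x. norm (u x) \<le> M" if "u \<in> S"
    using S that bdd_ucont_iff unfolding cstar_subalgebra_def by blast
  show "continuous_on UNIV u" if "u \<in> S"
    using S that uniformly_continuous_imp_continuous unfolding cstar_subalgebra_def bdd_ucont_def by blast
qed (use S in \<open>unfold cstar_subalgebra_def, blast+\<close>)

end

text \<open>
  The hypothesis makes \<^const>\<open>bdd_ucont\<close> itself a member of the intersected family, so that the
  intersection consists of bounded uniformly continuous functions.
\<close>
lemma cstar_subalgebra_hull:
  assumes "G \<subseteq> bdd_ucont"
  shows "cstar_subalgebra (cstar_subalgebra hull G)"
proof -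
  define T where "T = {S. cstar_subalgebra S \<and> G \<subseteq> S}"
  have T: "cstar_subalgebra S" if "S \<in> T" for S using that by (simp add: T_def)
  have "bdd_ucont \<in> T"
    using assms cstar_subalgebra_bdd_ucont by (simp add: T_def)
  have "cstar_subalgebra (\<Inter>T)"
    unfolding cstar_subalgebra_def
  proof (intro conjI ballI allI impI)
    show "\<Inter>T \<subseteq> bdd_ucont" using \<open>bdd_ucont \<in> T\<close> by blast
    show "u \<in> \<Inter>T" if "(\<forall>n. f n \<in> \<Inter>T) \<and> uniform_limit UNIV f u sequentially" for f u
      using that cstar_limit[OF T, of _ f u] by blast
  qed (use T in \<open>auto intro: cstar_zero cstar_add cstar_scale cstar_mult cstar_cnj\<close>)
  then show ?thesis by (simp add: hull_def T_def)
qed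

text \<open>
  The algebra \<open>\<E>(X / Y)\<close>, as a subalgebra of \<open>\<E>(X)\<close>.
\<close>
definition quot_algebra :: "'a::real_normed_vector set \<Rightarrow> ('a \<Rightarrow> complex) set" where
  "quot_algebra Y = cstar_subalgebra hull (\<Union>Z\<in>{Z. subspace Z \<and> Y \<subseteq> Z}. radial_algebra Z)"

lemma radial_in_quot_algebra:
  "subspace Z \<Longrightarrow> Y \<subseteq> Z \<Longrightarrow> u \<in> radial_algebra Z \<Longrightarrow> u \<in> quot_algebra Y"
  unfolding quot_algebra_def by (rule hull_inc) blast

lemma const_in_quot_algebra: "(\<lambda>x. c) \<in> quot_algebra Y"
  by (rule radial_in_quot_algebra[OF subspace_UNIV subset_UNIV const_in_radial_algebra])

lemma quot_algebra_antimono: "Y \<subseteq> Y' \<Longrightarrow> quot_algebra Y' \<subseteq> quot_algebra Y"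
  unfolding quot_algebra_def by (rule hull_mono) blast

lemma asymp_algebra_eq: "asymp_algebra = quot_algebra {0}"
proof -
  have "{Z :: 'a set. subspace Z} = {Z. subspace Z \<and> {0} \<subseteq> Z}" using subspace_0 by auto
  then show ?thesis by (simp add: asymp_algebra_def quot_algebra_def)
qed

lemma quot_eval_invariant:
  assumes Y: "subspace Y" and u: "invariant_under Y u"
  shows "quot_eval u (quot_proj Y x) = u x"
proof -
  have "u z = u x" if "z \<in> quot_proj Y x" for z
    using u that by (auto simp: quot_proj_def invariant_under_def)
  moreover have "x + 0 \<in> quot_proj Y x"
    unfolding quot_proj_def using subspace_0[OF Y] by (rule imageI)
  ultimately have "u ` quot_proj Y x = {u x}"
    unfolding add_0_right by blast
  then show ?thesis by (simp add: quot_eval_def)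
qed

context
  assumes fin: "\<exists>B :: 'a::real_normed_vector set. finite B \<and> span B = UNIV"
begin

lemma cstar_subalgebra_quot_algebra: "cstar_subalgebra (quot_algebra (Y :: 'a set))"
  unfolding quot_algebra_def using radial_algebra_bdd_ucont[OF fin] by (intro cstar_subalgebra_hull) blast

lemma quot_algebra_induct [consumes 1, case_names radial add scale mult cnj limit]:
  fixes Y :: "'a set"
  assumes u: "u \<in> quot_algebra Y"
    and radial: "\<And>Z u. subspace Z \<Longrightarrow> Y \<subseteq> Z \<Longrightarrow> u \<in> radial_algebra Z \<Longrightarrow> P u"
    and add: "\<And>u v. u \<in> quot_algebra Y \<Longrightarrow> v \<in> quot_algebra Y \<Longrightarrow> P u \<Longrightarrow> P v \<Longrightarrow> P (\<lambda>x. u x + v x)"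
    and scale: "\<And>c u. u \<in> quot_algebra Y \<Longrightarrow> P u \<Longrightarrow> P (\<lambda>x. c * u x)"
    and mult: "\<And>u v. u \<in> quot_algebra Y \<Longrightarrow> v \<in> quot_algebra Y \<Longrightarrow> P u \<Longrightarrow> P v \<Longrightarrow> P (\<lambda>x. u x * v x)"
    and cnj: "\<And>u. u \<in> quot_algebra Y \<Longrightarrow> P u \<Longrightarrow> P (\<lambda>x. cnj (u x))"
    and limit: "\<And>f u. (\<And>n. f n \<in> quot_algebra Y) \<Longrightarrow> (\<And>n. P (f n)) \<Longrightarrow>
      uniform_limit UNIV f u sequentially \<Longrightarrow> P u"
  shows "P u"
proof -
  note C = cstar_subalgebra_quot_algebra[of Y]
  let ?T = "{u \<in> quot_algebra Y. P u}"
  have "cstar_subalgebra ?T"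
    unfolding cstar_subalgebra_def
  proof (intro conjI ballI allI impI)
    show "?T \<subseteq> bdd_ucont" using C unfolding cstar_subalgebra_def by blast
    show "(\<lambda>x. 0) \<in> ?T"
      using radial[OF subspace_UNIV subset_UNIV const_in_radial_algebra] cstar_zero[OF C] by blast
    show "u \<in> ?T" if "(\<forall>n. f n \<in> ?T) \<and> uniform_limit UNIV f u sequentially" for f u
      using limit[of f u] cstar_limit[OF C, of f u] that by blast
  qed (use add scale mult cnj cstar_add[OF C] cstar_scale[OF C] cstar_mult[OF C] cstar_cnj[OF C] in auto)
  then have "quot_algebra Y \<subseteq> ?T"
    using radial radial_in_quot_algebra unfolding quot_algebra_def[of Y]
    by (intro hull_minimal) (auto simp: quot_algebra_def)
  then show ?thesis using u by blast
qed

lemma quot_algebra_invariant: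
  fixes Y :: "'a set"
  assumes "u \<in> quot_algebra Y"
  shows "invariant_under Y u"
  using assms
proof (induction rule: quot_algebra_induct)
  case (radial Z u)
  then show ?case using radial_algebraD(2)[of u Z] by (auto simp: invariant_under_def)
next
  case (limit f u)
  show ?case
    unfolding invariant_under_def
  proof (intro allI impI)
    fix x y assume "x - y \<in> Y"
    then have "(\<lambda>n. f n x) = (\<lambda>n. f n y)" using limit.IH by (simp add: invariant_under_def)
    then show "u x = u y"
      using tendsto_uniform_limitI[OF limit.hyps(2), of x] tendsto_uniform_limitI[OF limit.hyps(2), of y]
      by (auto intro: LIMSEQ_unique)
  qed
qed (simp_all add: invariant_under_def)

lemma quot_algebra_tendsto_coset:
  fixes Y :: "'a set"
  assumes "subspace Y" "u \<in> quot_algebra Y"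
  shows "(u \<longlongrightarrow> u a) (coset_nhds Y a)"
  using invariant_tendsto_coset_nhds[OF fin assms(1)]
    cstar_continuous[OF cstar_subalgebra_quot_algebra assms(2)] quot_algebra_invariant[OF assms(2)] by blast

section \<open>Translation to infinity\<close>

text \<open>
  The ray stays in one coset of \<open>Y + \<real>a\<close>, where \<open>v\<close> is constant, and enters the cones around
  \<open>a\<close>, where \<open>u - v\<close> vanishes asymptotically.
\<close>
lemma tendsto_along_ray:
  fixes Y :: "'a set"
  assumes Y: "subspace Y" and uv: "((\<lambda>x. u x - v x) \<longlongrightarrow> 0) (cone_at_inf Y a)"
    and v: "invariant_under (span (insert a Y)) v" and a': "a' - s *\<^sub>R a \<in> Y" "s > 0"
  shows "((\<lambda>r. u (r *\<^sub>R a' + x)) \<longlongrightarrow> v x) at_top"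
proof -
  have "a' \<in> span (insert a Y)"
    using a' span_superset[of Y] by (auto simp: span_insert)
  then have "v (r *\<^sub>R a' + x) = v x" for r
    using v span_scale[of a' _ r] by (simp add: invariant_under_def)
  moreover have "((\<lambda>r. u (r *\<^sub>R a' + x) - v (r *\<^sub>R a' + x)) \<longlongrightarrow> 0) at_top"
    using uv filterlim_ray_cone_at_inf[OF Y a'] by (rule filterlim_compose)
  ultimately show ?thesis by (simp add: LIM_zero_iff)
qed

text \<open>
  The asymptotic part \<open>v\<close> is obtained for radial functions and transported through the algebra
  operations. For uniform limits, the values of \<open>v\<close> are limits of values of \<open>u\<close> along rays, so the
  asymptotic parts of a uniformly Cauchy sequence are again uniformly Cauchy.
\<close>
lemma asymptotic_part_exists:
  fixes Y :: "'a set"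
  assumes Y: "subspace Y" and a: "a \<notin> Y" and u: "u \<in> quot_algebra Y"
  shows "\<exists>v\<in>quot_algebra (span (insert a Y)). ((\<lambda>x. u x - v x) \<longlongrightarrow> 0) (cone_at_inf Y a)"
  using u
proof (induction rule: quot_algebra_induct)
  case (radial Z u)
  show ?case
  proof (cases "a \<in> Z")
    case True
    then have "span (insert a Y) \<subseteq> Z"
      using radial by (intro span_minimal) auto
    then show ?thesis
      using radial radial_in_quot_algebra by (intro bexI[of _ u]) auto
  next
    case False
    then obtain L where "(u \<longlongrightarrow> L) (cone_at_inf Z a)"
      using radial_tendsto_cone_at_inf[OF fin] radial by blast
    then have "(u \<longlongrightarrow> L) (cone_at_inf Y a)"
      using cone_at_inf_mono[OF Y] radial by (auto intro: tendsto_mono)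
    then show ?thesis
      by (intro bexI[of _ "\<lambda>_. L"] const_in_quot_algebra) (simp add: LIM_zero)
  qed
next
  case (add u1 u2)
  then obtain v1 v2 where v: "v1 \<in> quot_algebra (span (insert a Y))" "v2 \<in> quot_algebra (span (insert a Y))"
    "((\<lambda>x. u1 x - v1 x) \<longlongrightarrow> 0) (cone_at_inf Y a)" "((\<lambda>x. u2 x - v2 x) \<longlongrightarrow> 0) (cone_at_inf Y a)"
    by blast
  show ?case
    using tendsto_add_zero[OF v(3,4)] cstar_add[OF cstar_subalgebra_quot_algebra v(1,2)]
    by (intro bexI[of _ "\<lambda>x. v1 x + v2 x"]) (simp_all add: algebra_simps)
next
  case (scale c u1)
  then obtain v1 where v: "v1 \<in> quot_algebra (span (insert a Y))"
    "((\<lambda>x. u1 x - v1 x) \<longlongrightarrow> 0) (cone_at_inf Y a)"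
    by blast
  show ?case
    using tendsto_mult_right_zero[OF v(2)] cstar_scale[OF cstar_subalgebra_quot_algebra v(1)]
    by (intro bexI[of _ "\<lambda>x. c * v1 x"]) (simp_all add: algebra_simps)
next
  case (mult u1 u2)
  then obtain v1 v2 where v: "v1 \<in> quot_algebra (span (insert a Y))" "v2 \<in> quot_algebra (span (insert a Y))"
    "((\<lambda>x. u1 x - v1 x) \<longlongrightarrow> 0) (cone_at_inf Y a)" "((\<lambda>x. u2 x - v2 x) \<longlongrightarrow> 0) (cone_at_inf Y a)"
    by blast
  obtain M M' where "\<And>x. norm (u2 x) \<le> M" "\<And>x. norm (v1 x) \<le> M'"
    using cstar_bounded[OF cstar_subalgebra_quot_algebra] mult.hyps(2) v(1) by metis
  then show ?case
    using tendsto_diff_zero_mult[OF v(3,4)] cstar_mult[OF cstar_subalgebra_quot_algebra v(1,2)]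
    by (intro bexI[of _ "\<lambda>x. v1 x * v2 x"]) auto
next
  case (cnj u1)
  then obtain v1 where v: "v1 \<in> quot_algebra (span (insert a Y))"
    "((\<lambda>x. u1 x - v1 x) \<longlongrightarrow> 0) (cone_at_inf Y a)"
    by blast
  show ?case
    using tendsto_cnj[OF v(2)] cstar_cnj[OF cstar_subalgebra_quot_algebra v(1)]
    by (intro bexI[of _ "\<lambda>x. cnj (v1 x)"]) simp_all
next
  case (limit f u)
  let ?Y' = "span (insert a Y)"
  obtain v where v: "\<And>n. v n \<in> quot_algebra ?Y'"
      "\<And>n. ((\<lambda>x. f n x - v n x) \<longlongrightarrow> 0) (cone_at_inf Y a)"
    using limit.IH by metis
  have lim: "((\<lambda>r. f n (r *\<^sub>R a + x)) \<longlongrightarrow> v n x) at_top" for n x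
    using tendsto_along_ray[OF Y v(2) quot_algebra_invariant[OF v(1)], of a 1] subspace_0[OF Y] by simp
  have "uniformly_Cauchy_on UNIV v"
    unfolding uniformly_Cauchy_on_def
  proof (intro allI impI)
    fix e :: real assume e: "e > 0"
    have "uniformly_convergent_on UNIV f" using limit.hyps(2) by (auto simp: uniformly_convergent_on_def)
    then have "uniformly_Cauchy_on UNIV f" by (rule uniformly_convergent_Cauchy)
    then obtain N where N: "\<And>x m n. m \<ge> N \<Longrightarrow> n \<ge> N \<Longrightarrow> dist (f m x) (f n x) < e / 2"
      unfolding uniformly_Cauchy_on_def using half_gt_zero[OF e] by (metis UNIV_I)
    have "dist (v m x) (v n x) < e" if "m \<ge> N" "n \<ge> N" for m n x
    proof -
      have "dist (v m x) (v n x) \<le> e / 2"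
      proof (rule tendsto_upperbound)
        show "((\<lambda>r. dist (f m (r *\<^sub>R a + x)) (f n (r *\<^sub>R a + x))) \<longlongrightarrow> dist (v m x) (v n x)) at_top"
          by (intro tendsto_dist lim)
        show "\<forall>\<^sub>F r in at_top. dist (f m (r *\<^sub>R a + x)) (f n (r *\<^sub>R a + x)) \<le> e / 2"
          using N[OF that] less_imp_le by (intro always_eventually) blast
      qed simp
      then show ?thesis using e by simp
    qed
    then show "\<exists>M. \<forall>x\<in>UNIV. \<forall>m\<ge>M. \<forall>n\<ge>M. dist (v m x) (v n x) < e" by blast
  qed
  then obtain w where w: "uniform_limit UNIV v w sequentially"
    using Cauchy_uniformly_convergent uniformly_convergent_on_def by blast
  have "((\<lambda>x. u x - w x) \<longlongrightarrow> 0) (cone_at_inf Y a)"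
  proof (rule tendsto_diff_zero_approx)
    fix e :: real assume e: "e > 0"
    have "eventually (\<lambda>n. (\<forall>x\<in>UNIV. dist (f n x) (u x) < e) \<and> (\<forall>x\<in>UNIV. dist (v n x) (w x) < e)) sequentially"
      using uniform_limitD[OF limit.hyps(2) e] uniform_limitD[OF w e] by eventually_elim auto
    then obtain n where "\<And>x. dist (f n x) (u x) < e" "\<And>x. dist (v n x) (w x) < e"
      by (auto simp: eventually_sequentially)
    then show "\<exists>f' g'. (\<forall>t. dist (u t) (f' t) < e) \<and> (\<forall>t. dist (w t) (g' t) < e) \<and>
        ((\<lambda>t. f' t - g' t) \<longlongrightarrow> 0) (cone_at_inf Y a)"
      using v(2)[of n] by (intro exI[of _ "f n"] exI[of _ "v n"]) (auto simp: dist_commute)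
  qed
  then show ?case
    using cstar_limit[OF cstar_subalgebra_quot_algebra v(1) w] by blast
qed

end

lemma half_line_representative:
  assumes Y: "subspace Y" and b: "quot_proj Y b \<in> half_line Y a"
  obtains s where "s > 0" "b - s *\<^sub>R a \<in> Y"
  using b that unfolding half_line_def by (auto simp: quot_proj_eq_iff[OF Y])

lemma line_preimage_half_line:
  assumes Y: "subspace Y"
  shows "line_preimage Y (half_line Y a) = span (insert a Y)"
proof -
  have sp: "x \<in> span (insert a Y) \<longleftrightarrow> (\<exists>k. x - k *\<^sub>R a \<in> Y)" for x
    unfolding span_insert using Y by (simp add: span_eq_iff[THEN iffD2])
  show ?thesis
  proof (intro set_eqI iffI)
    fix x assume "x \<in> line_preimage Y (half_line Y a)"
    then obtain b t where b: "quot_proj Y b \<in> half_line Y a" and x: "x - t *\<^sub>R b \<in> Y"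
      unfolding line_preimage_def by (auto simp: quot_proj_eq_iff[OF Y])
    obtain s where "b - s *\<^sub>R a \<in> Y"
      using half_line_representative[OF Y b] by blast
    then have "(x - t *\<^sub>R b) + t *\<^sub>R (b - s *\<^sub>R a) \<in> Y"
      using x Y by (intro subspace_add subspace_scale)
    then have "x - (t * s) *\<^sub>R a \<in> Y" by (simp add: algebra_simps)
    then show "x \<in> span (insert a Y)" using sp by blast
  next
    fix x assume "x \<in> span (insert a Y)"
    then obtain k where k: "x - k *\<^sub>R a \<in> Y" using sp by blast
    have "quot_proj Y (1 *\<^sub>R a) \<in> half_line Y a"
      unfolding half_line_def using zero_less_one by blast
    then have "quot_proj Y a \<in> half_line Y a" by simp
    then show "x \<in> line_preimage Y (half_line Y a)"
      unfolding line_preimage_def using k quot_proj_eq_iff[OF Y] by blast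
  qed
qed

lemma is_family_from_Cons_iff:
  assumes "subspace Y"
  shows "is_family_from Y (\<alpha> # \<alpha>s) \<longleftrightarrow>
    (\<exists>a. a \<notin> Y \<and> \<alpha> = half_line Y a \<and> is_family_from (span (insert a Y)) \<alpha>s)"
  using line_preimage_half_line[OF assms] by (auto simp: sphere_at_inf_def)

context
  assumes fin: "\<exists>B :: 'a::real_normed_vector set. finite B \<and> span B = UNIV"
begin

text \<open>
  Every half-line of a family raises the dimension of the subspace by one.
\<close>
lemma is_family_from_length:
  fixes Y :: "'a set"
  assumes "subspace Y" "is_family_from Y \<alpha>s"
  shows "dim Y + length \<alpha>s \<le> dim (UNIV :: 'a set)"
  using assms
proof (induction \<alpha>s arbitrary: Y)
  case Nil
  then show ?case using dim_le_dim_UNIV fin by auto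
next
  case (Cons \<alpha> \<alpha>s)
  then obtain a where "a \<notin> Y" "is_family_from (span (insert a Y)) \<alpha>s"
    using is_family_from_Cons_iff by blast
  then show ?case
    using Cons.IH[of "span (insert a Y)"] dim_span_insert_new[OF _ _ Cons.prems(1)] fin by auto
qed

text \<open>
  This identifies \<open>\<tau>\<^sub>\<alpha> u\<close> with the asymptotic part of \<open>u\<close>, and thereby shows that the asymptotic part is
  unique; the algebraic properties of \<open>\<tau>\<^sub>\<alpha>\<close> follow from this uniqueness.
\<close>
lemma tau_eqI:
  fixes Y :: "'a set"
  assumes Y: "subspace Y" and v: "v \<in> quot_algebra (span (insert a Y))"
    and uv: "((\<lambda>x. u x - v x) \<longlongrightarrow> 0) (cone_at_inf Y a)"
  shows "tau Y (half_line Y a) u = v"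
proof
  fix x
  define a' where "a' = (SOME b. quot_proj Y b \<in> half_line Y a)"
  have "quot_proj Y (1 *\<^sub>R a) \<in> half_line Y a"
    unfolding half_line_def using zero_less_one by blast
  then have "quot_proj Y a' \<in> half_line Y a"
    unfolding a'_def by (rule someI)
  then obtain s where "s > 0" "a' - s *\<^sub>R a \<in> Y"
    by (rule half_line_representative[OF Y])
  then have "((\<lambda>r. u (r *\<^sub>R a' + x)) \<longlongrightarrow> v x) at_top"
    using tendsto_along_ray[OF fin Y uv quot_algebra_invariant[OF fin v]] by blast
  then show "tau Y (half_line Y a) u x = v x"
    unfolding tau_def Let_def a'_def[symmetric] by (intro tendsto_Lim) simp_all
qed

lemma
  fixes Y :: "'a set"
  assumes Y: "subspace Y" and a: "a \<notin> Y" and u: "u \<in> quot_algebra Y"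
  shows tau_in_quot_algebra: "tau Y (half_line Y a) u \<in> quot_algebra (span (insert a Y))"
    and tau_asymptotic: "((\<lambda>x. u x - tau Y (half_line Y a) u x) \<longlongrightarrow> 0) (cone_at_inf Y a)"
  using asymptotic_part_exists[OF fin Y a u] tau_eqI[OF Y] by metis+

lemma tau_morphism:
  fixes Y :: "'a set"
  assumes Y: "subspace Y" and a: "a \<notin> Y"
  defines "\<tau> \<equiv> tau Y (half_line Y a)"
  shows "u \<in> quot_algebra Y \<Longrightarrow> v \<in> quot_algebra Y \<Longrightarrow> \<tau> (\<lambda>x. u x + v x) = (\<lambda>x. \<tau> u x + \<tau> v x)"
    and "u \<in> quot_algebra Y \<Longrightarrow> \<tau> (\<lambda>x. c * u x) = (\<lambda>x. c * \<tau> u x)"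
    and "u \<in> quot_algebra Y \<Longrightarrow> v \<in> quot_algebra Y \<Longrightarrow> \<tau> (\<lambda>x. u x * v x) = (\<lambda>x. \<tau> u x * \<tau> v x)"
    and "u \<in> quot_algebra Y \<Longrightarrow> \<tau> (\<lambda>x. cnj (u x)) = (\<lambda>x. cnj (\<tau> u x))"
    and "u \<in> quot_algebra (span (insert a Y)) \<Longrightarrow> \<tau> u = u"
proof -
  note C = cstar_subalgebra_quot_algebra[OF fin, of "span (insert a Y)"]
  note in' = tau_in_quot_algebra[OF Y a, folded \<tau>_def]
  note as = tau_asymptotic[OF Y a, folded \<tau>_def]
  note eqI = tau_eqI[OF Y, of _ a, folded \<tau>_def]
  show "\<tau> (\<lambda>x. u x + v x) = (\<lambda>x. \<tau> u x + \<tau> v x)"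
    if uv: "u \<in> quot_algebra Y" "v \<in> quot_algebra Y"
    using tendsto_add_zero[OF as[OF uv(1)] as[OF uv(2)]]
    by (intro eqI cstar_add[OF C] in' uv) (simp add: algebra_simps)
  show "\<tau> (\<lambda>x. c * u x) = (\<lambda>x. c * \<tau> u x)" if u: "u \<in> quot_algebra Y"
    using tendsto_mult_right_zero[OF as[OF u], of c]
    by (intro eqI cstar_scale[OF C] in' u) (simp add: algebra_simps)
  show "\<tau> (\<lambda>x. u x * v x) = (\<lambda>x. \<tau> u x * \<tau> v x)"
    if uv: "u \<in> quot_algebra Y" "v \<in> quot_algebra Y"
  proof (intro eqI cstar_mult[OF C] in' uv)
    obtain M M' where "\<And>x. norm (v x) \<le> M" "\<And>x. norm (\<tau> u x) \<le> M'"
      using cstar_bounded[OF cstar_subalgebra_quot_algebra[OF fin]] uv(2) in'[OF uv(1)] by metis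
    then show "((\<lambda>x. u x * v x - \<tau> u x * \<tau> v x) \<longlongrightarrow> 0) (cone_at_inf Y a)"
      by (rule tendsto_diff_zero_mult[OF as[OF uv(1)] as[OF uv(2)]])
  qed
  show "\<tau> (\<lambda>x. cnj (u x)) = (\<lambda>x. cnj (\<tau> u x))" if u: "u \<in> quot_algebra Y"
    using tendsto_cnj[OF as[OF u]] by (intro eqI cstar_cnj[OF C] in' u) simp
  show "\<tau> u = u" if "u \<in> quot_algebra (span (insert a Y))"
    using that by (intro eqI) simp_all
qed

text \<open>
  The composite does not vanish because \<open>\<tau>\<^sub>\<alpha>\<close> is a projection onto the smaller algebra.
\<close>
lemma character_comp_tau:
  fixes Y :: "'a set"
  assumes Y: "subspace Y" and a: "a \<notin> Y"
    and \<phi>: "character_on (quot_algebra (span (insert a Y))) \<phi>"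
  shows "character_on (quot_algebra Y) (\<lambda>u. \<phi> (tau Y (half_line Y a) u))"
proof -
  have "quot_algebra (span (insert a Y)) \<subseteq> quot_algebra Y"
    by (rule quot_algebra_antimono) (auto intro: span_base)
  then have "\<exists>u\<in>quot_algebra Y. \<phi> (tau Y (half_line Y a) u) \<noteq> 0"
    using \<phi> tau_morphism(5)[OF Y a] unfolding character_on_def by (metis subsetD)
  then show ?thesis
    using \<phi> tau_in_quot_algebra[OF Y a] unfolding character_on_def
    by (simp add: tau_morphism[OF Y a])
qed

lemma character_tau_from:
  fixes Y :: "'a set"
  assumes "subspace Y" "is_family_from Y \<alpha>s" "c \<in> quot_space (bracket_from Y \<alpha>s)"
  shows "character_on (quot_algebra Y) (\<lambda>u. quot_eval (tau_from Y \<alpha>s u) c)"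
  using assms
proof (induction \<alpha>s arbitrary: Y)
  case Nil
  then obtain x where x: "c = quot_proj Y x" by (auto simp: quot_space_def)
  have ev: "quot_eval u c = u x" if "u \<in> quot_algebra Y" for u
    unfolding x by (rule quot_eval_invariant[OF Nil.prems(1) quot_algebra_invariant[OF fin that]])
  note C = cstar_subalgebra_quot_algebra[OF fin, of Y]
  have "\<exists>u\<in>quot_algebra Y. quot_eval u c \<noteq> 0"
    using ev const_in_quot_algebra[of 1 Y] by (intro bexI[of _ "\<lambda>_. 1"]) auto
  then show ?case
    by (simp add: character_on_def ev cstar_add[OF C] cstar_scale[OF C] cstar_mult[OF C] cstar_cnj[OF C])
next
  case (Cons \<alpha> \<alpha>s)
  then obtain a where a: "a \<notin> Y" "\<alpha> = half_line Y a" "is_family_from (span (insert a Y)) \<alpha>s"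
    using is_family_from_Cons_iff by blast
  have "character_on (quot_algebra (span (insert a Y))) (\<lambda>u. quot_eval (tau_from (span (insert a Y)) \<alpha>s u) c)"
    using Cons.prems a by (intro Cons.IH) (simp_all add: line_preimage_half_line)
  then show ?case
    using character_comp_tau[OF Cons.prems(1) a(1)] Cons.prems(1)
    by (simp add: a(2) line_preimage_half_line)
qed

section \<open>Every character is a limit of point evaluations\<close>

text \<open>
  The compactness of the successive quotients supplies the convergence. The induction is on the
  dimension of \<open>X / Y\<close>, since each direction at infinity that the filter picks enlarges \<open>Y\<close> by a line.
\<close>
lemma filter_converging_to_composed_character:
  fixes Y :: "'a set" and F :: "'a filter"
  assumes "subspace Y" "F \<noteq> bot"
  shows "\<exists>\<alpha>s c F'. is_family_from Y \<alpha>s \<and> c \<in> quot_space (bracket_from Y \<alpha>s) \<and> F' \<le> F \<and> F' \<noteq> bot \<and>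
    (\<forall>u\<in>quot_algebra Y. (u \<longlongrightarrow> quot_eval (tau_from Y \<alpha>s u) c) F')"
  using assms
proof (induction "dim (UNIV :: 'a set) - dim Y" arbitrary: Y F rule: less_induct)
  case less
  note Y = less.prems(1)
  obtain F1 a where F1: "F1 \<le> F" "F1 \<noteq> bot"
      and "filterlim (\<lambda>x. x) (coset_nhds Y a) F1 \<or> a \<notin> Y \<and> filterlim (\<lambda>x. x) (cone_at_inf Y a) F1"
    using filter_refinement_in_quotient[OF fin less.prems, of "\<lambda>x. x"] by blast
  then consider "F1 \<le> coset_nhds Y a" | "a \<notin> Y" "F1 \<le> cone_at_inf Y a"
    by (auto simp: filterlim_def filtermap_ident)
  then show ?case
  proof cases
    case 1
    have "(u \<longlongrightarrow> quot_eval (tau_from Y [] u) (quot_proj Y a)) F1" if u: "u \<in> quot_algebra Y" for u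
      using tendsto_mono[OF 1 quot_algebra_tendsto_coset[OF fin Y u]]
        quot_eval_invariant[OF Y quot_algebra_invariant[OF fin u]] by simp
    moreover have "is_family_from Y []" "quot_proj Y a \<in> quot_space (bracket_from Y [])"
      by (simp_all add: quot_space_def)
    ultimately show ?thesis using F1 by blast
  next
    case 2
    let ?Y' = "span (insert a Y)"
    let ?\<alpha> = "half_line Y a"
    obtain B where B: "finite B" "span B = (UNIV :: 'a set)" using fin by blast
    have "dim (UNIV :: 'a set) - dim ?Y' < dim (UNIV :: 'a set) - dim Y"
      using dim_span_insert_new[OF B Y 2(1)] dim_le_dim_UNIV[OF B, of ?Y'] by linarith
    then obtain \<alpha>s c F' where IH: "is_family_from ?Y' \<alpha>s" "c \<in> quot_space (bracket_from ?Y' \<alpha>s)"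
        "F' \<le> F1" "F' \<noteq> bot"
        "\<And>u. u \<in> quot_algebra ?Y' \<Longrightarrow> (u \<longlongrightarrow> quot_eval (tau_from ?Y' \<alpha>s u) c) F'"
      using less.hyps[OF _ subspace_span F1(2), of "insert a Y"] by blast
    have "(u \<longlongrightarrow> quot_eval (tau_from Y (?\<alpha> # \<alpha>s) u) c) F'" if u: "u \<in> quot_algebra Y" for u
    proof -
      have "((\<lambda>x. u x - tau Y ?\<alpha> u x) \<longlongrightarrow> 0) F'"
        using tau_asymptotic[OF Y 2(1) u] 2(2) IH(3) by (meson order_trans tendsto_mono)
      from tendsto_add[OF this IH(5)[OF tau_in_quot_algebra[OF Y 2(1) u]]]
      show ?thesis by (simp add: line_preimage_half_line[OF Y])
    qed
    moreover have "is_family_from Y (?\<alpha> # \<alpha>s)"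
      using IH(1) 2(1) is_family_from_Cons_iff[OF Y] by blast
    moreover have "c \<in> quot_space (bracket_from Y (?\<alpha> # \<alpha>s))"
      using IH(2) by (simp add: line_preimage_half_line[OF Y])
    moreover have "F' \<le> F" using IH(3) F1(1) by simp
    ultimately show ?thesis using IH(4) by blast
  qed
qed

end

lemma character_one:
  fixes S :: "('a::real_normed_vector \<Rightarrow> complex) set"
  assumes one: "(\<lambda>x. 1) \<in> S" and \<phi>: "character_on S \<phi>"
  shows "\<phi> (\<lambda>x. 1) = 1"
proof -
  have mult: "\<phi> (\<lambda>x. u x * v x) = \<phi> u * \<phi> v" if "u \<in> S" "v \<in> S" for u v
    using \<phi> that by (simp add: character_on_def)
  obtain u where "u \<in> S" "\<phi> u \<noteq> 0" using \<phi> by (auto simp: character_on_def)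
  then show ?thesis using mult[OF _ one] by fastforce
qed

text \<open>
  Since \<open>\<parallel>h\<parallel> < 1\<close>, the algebra contains the sum \<open>w\<close> of the geometric series in \<open>h\<close>, and applying \<open>\<phi>\<close>
  to \<open>w = h w + 1\<close> excludes \<open>\<phi>(h) = 1\<close>.
\<close>
lemma character_neumann:
  fixes S :: "('a::real_normed_vector \<Rightarrow> complex) set"
  assumes S: "cstar_subalgebra S" and one: "(\<lambda>x. 1) \<in> S" and \<phi>: "character_on S \<phi>"
    and h: "h \<in> S" "\<And>x. norm (h x) \<le> q" "q < 1"
  shows "\<phi> h \<noteq> 1"
proof
  assume h1: "\<phi> h = 1"
  have q: "q \<ge> 0" using h(2) norm_ge_zero order_trans by blast
  have pow: "(\<lambda>x. h x ^ k) \<in> S" for k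
    by (induction k) (use one cstar_mult[OF S h(1)] in auto)
  have part: "(\<lambda>x. \<Sum>k<n. h x ^ k) \<in> S" for n
    by (induction n) (use pow cstar_zero[OF S] cstar_add[OF S] in auto)
  define w where "w x = (\<Sum>k. h x ^ k)" for x
  have "uniform_limit UNIV (\<lambda>n x. \<Sum>k<n. h x ^ k) w sequentially"
    unfolding w_def
  proof (rule Weierstrass_m_test)
    show "norm (h x ^ k) \<le> q ^ k" for k x
      using h(2) by (simp add: norm_power power_mono)
    show "summable (\<lambda>k. q ^ k)" using q h(3) by (intro summable_geometric) simp
  qed
  then have w: "w \<in> S" using part by (rule cstar_limit[OF S, rotated])
  have "h x * w x + 1 = w x" for x
  proof -
    have "norm (h x) < 1" using h(2)[of x] h(3) by simp
    then have "w x = 1 / (1 - h x)" "h x \<noteq> 1" unfolding w_def using suminf_geometric by auto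
    then show ?thesis by (simp add: field_simps)
  qed
  then have "\<phi> w = \<phi> (\<lambda>x. h x * w x + 1)" by simp
  also have "\<dots> = \<phi> h * \<phi> w + \<phi> (\<lambda>x. 1)"
    using \<phi> h(1) w one cstar_mult[OF S h(1) w] by (simp add: character_on_def)
  finally show False using h1 character_one[OF one \<phi>] by simp
qed

text \<open>
  The filter is the coarsest one along which every \<open>u \<in> S\<close> tends to \<open>\<phi>(u)\<close>. It is proper because finitely
  many conditions can be met at once: \<open>g = \<Sum> |u - \<phi>(u)|\<^sup>2\<close> lies in the kernel of \<open>\<phi>\<close>, and a positive
  lower bound for \<open>g\<close> would give \<open>1 - g / M\<close> norm less than one, whereas \<open>\<phi>\<close> maps it to \<open>1\<close>.
\<close>
lemma character_limit_of_evaluations: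
  fixes S :: "('a::real_normed_vector \<Rightarrow> complex) set"
  assumes S: "cstar_subalgebra S" and one: "(\<lambda>x. 1) \<in> S" and \<phi>: "character_on S \<phi>"
  obtains F where "F \<noteq> bot" "\<And>u. u \<in> S \<Longrightarrow> (u \<longlongrightarrow> \<phi> u) F"
proof -
  let ?G = "\<lambda>u. filtercomap u (nhds (\<phi> u))"
  have \<phi>D: "\<phi> (\<lambda>x. u x + v x) = \<phi> u + \<phi> v" "\<phi> (\<lambda>x. c * u x) = c * \<phi> u"
      "\<phi> (\<lambda>x. u x * v x) = \<phi> u * \<phi> v" "\<phi> (\<lambda>x. cnj (u x)) = cnj (\<phi> u)"
    if "u \<in> S" "v \<in> S" for u v c
    using \<phi> that by (auto simp: character_on_def)
  have \<phi>1: "\<phi> (\<lambda>x. 1) = 1" by (rule character_one[OF one \<phi>])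
  have const: "(\<lambda>x. c) \<in> S" "\<phi> (\<lambda>x. c) = c" for c
    using cstar_scale[OF S one, of c] \<phi>D(2)[OF one one, of c] \<phi>1 by auto
  have fin_INF: "(INF u\<in>X. ?G u) \<noteq> bot" if X: "X \<subseteq> S" "finite X" for X
  proof -
    define g where "g x = (\<Sum>u\<in>X. (norm (u x - \<phi> u))\<^sup>2)" for x
    have g0: "g x \<ge> 0" for x unfolding g_def by (intro sum_nonneg) simp
    have gS: "(\<lambda>x. complex_of_real (g x)) \<in> S \<and> \<phi> (\<lambda>x. complex_of_real (g x)) = 0"
      unfolding g_def using X(2,1)
    proof (induction X rule: finite_induct)
      case empty
      then show ?case using const[of 0] by simp
    next
      case (insert u X)
      let ?u = "\<lambda>x. u x + (- \<phi> u)"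
      let ?s = "\<lambda>x. complex_of_real (\<Sum>u\<in>X. (norm (u x - \<phi> u))\<^sup>2)"
      have uS: "u \<in> S" using insert.prems by simp
      have 1: "?u \<in> S" using cstar_add[OF S uS const(1)] .
      have 2: "\<phi> ?u = 0" unfolding \<phi>D(1)[OF uS const(1)] const(2) by simp
      have 3: "(\<lambda>x. ?u x * cnj (?u x)) \<in> S" using cstar_mult[OF S 1 cstar_cnj[OF S 1]] .
      have 4: "\<phi> (\<lambda>x. ?u x * cnj (?u x)) = 0"
        using \<phi>D(3)[OF 1 cstar_cnj[OF S 1]] 2 by simp
      have IH: "?s \<in> S" "\<phi> ?s = 0" using insert by auto
      have eq: "(\<lambda>x. complex_of_real (\<Sum>u\<in>insert u X. (norm (u x - \<phi> u))\<^sup>2)) =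
          (\<lambda>x. ?u x * cnj (?u x) + ?s x)"
      proof
        fix x
        have "complex_of_real ((norm (u x - \<phi> u))\<^sup>2) = ?u x * cnj (?u x)"
          using complex_norm_square[of "u x - \<phi> u"] by simp
        then show "complex_of_real (\<Sum>u\<in>insert u X. (norm (u x - \<phi> u))\<^sup>2) = ?u x * cnj (?u x) + ?s x"
          unfolding sum.insert[OF insert.hyps] of_real_add by (rule arg_cong)
      qed
      show ?case
        unfolding eq using cstar_add[OF S 3 IH(1)] \<phi>D(1)[OF 3 IH(1)] 4 IH(2) by simp
    qed
    have small: "\<exists>x. g x < e" if e: "e > 0" for e
    proof (rule ccontr)
      assume "\<not> ?thesis"
      then have ge: "g x \<ge> e" for x by (simp add: not_less)
      obtain M where M: "\<And>x. norm (complex_of_real (g x)) \<le> M"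
        using cstar_bounded[OF S] gS by blast
      have gM: "g x \<le> M" for x using M[of x] by simp
      have Mp: "M > 0" using e ge gM order.strict_trans2 by (meson less_le_trans)
      \<comment> \<open>\<open>h = 1 - g / M\<close> takes values in \<open>[0, 1 - e / M]\<close>.\<close>
      let ?c = "- complex_of_real (1 / M)"
      let ?h = "\<lambda>x. ?c * complex_of_real (g x) + 1"
      have cS: "(\<lambda>x. ?c * complex_of_real (g x)) \<in> S" using gS by (intro cstar_scale[OF S]) simp
      have "\<phi> ?h = 1"
        using \<phi>D(1)[OF cS one] \<phi>D(2)[of "\<lambda>x. complex_of_real (g x)" _ ?c] gS one \<phi>1 by simp
      moreover have "?h \<in> S" using cstar_add[OF S cS one] .
      moreover have "norm (?h x) \<le> 1 - e / M" for x
      proof -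
        have "?h x = complex_of_real (1 - g x / M)" by simp
        then have "norm (?h x) = \<bar>1 - g x / M\<bar>" by (simp only: norm_of_real)
        then show ?thesis using ge[of x] gM[of x] Mp by (simp add: divide_right_mono)
      qed
      moreover have "1 - e / M < 1" using e Mp by simp
      ultimately show False using character_neumann[OF S one \<phi>] by blast
    qed
    have "filtercomap g (nhds 0) \<noteq> bot"
    proof (rule filtercomap_neq_bot)
      fix P assume "eventually P (nhds (0::real))"
      then obtain e where "e > 0" "\<And>y. dist y 0 < e \<Longrightarrow> P y"
        unfolding eventually_nhds_metric by blast
      then show "\<exists>x. P (g x)" using small[of e] g0 by (metis abs_of_nonneg dist_0_norm dist_commute real_norm_def)
    qed
    moreover have "filtercomap g (nhds 0) \<le> ?G u" if u: "u \<in> X" for u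
    proof -
      have "((\<lambda>x. u x - \<phi> u) \<longlongrightarrow> 0) (filtercomap g (nhds 0))"
      proof (rule Lim_null_comparison)
        have "((\<lambda>x. sqrt (g x)) \<longlongrightarrow> sqrt 0) (filtercomap g (nhds 0))"
          by (intro tendsto_real_sqrt filterlim_filtercomap)
        then show "((\<lambda>x. sqrt (g x)) \<longlongrightarrow> 0) (filtercomap g (nhds 0))" by simp
        have "(norm (u x - \<phi> u))\<^sup>2 \<le> g x" for x
          unfolding g_def using X(2) u by (intro member_le_sum) auto
        then show "\<forall>\<^sub>F x in filtercomap g (nhds 0). norm (u x - \<phi> u) \<le> sqrt (g x)"
          by (intro always_eventually allI real_le_rsqrt)
      qed
      then have "filterlim u (nhds (\<phi> u)) (filtercomap g (nhds 0))" by (simp add: LIM_zero_iff)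
      then show ?thesis by (simp add: filterlim_iff_le_filtercomap)
    qed
    then have "filtercomap g (nhds 0) \<le> (INF u\<in>X. ?G u)" by (intro INF_greatest)
    ultimately show ?thesis by (metis bot.extremum_uniqueI)
  qed
  have "(INF u\<in>S. ?G u) \<noteq> bot" by (rule INF_filter_not_bot[OF fin_INF])
  moreover have "(u \<longlongrightarrow> \<phi> u) (INF u\<in>S. ?G u)" if "u \<in> S" for u
    by (rule filterlim_mono[OF filterlim_filtercomap order_refl INF_lower[OF that]])
  ultimately show ?thesis using that by blast
qed

theorem theorem2:
  assumes "\<exists>B :: 'a::real_normed_vector set. finite B \<and> span B = UNIV"
  shows "(\<forall>\<alpha>s\<in>families. \<forall>a\<in>quot_space (bracket \<alpha>s).
            character_on (asymp_algebra :: ('a \<Rightarrow> complex) set)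
              (\<lambda>u. quot_eval (tau_family \<alpha>s u) a)) \<and>
         (\<forall>\<phi>. character_on (asymp_algebra :: ('a \<Rightarrow> complex) set) \<phi> \<longrightarrow>
            (\<exists>\<alpha>s\<in>families. \<exists>a\<in>quot_space (bracket \<alpha>s).
               \<forall>u\<in>asymp_algebra. \<phi> u = quot_eval (tau_family \<alpha>s u) a))"
proof (intro conjI ballI allI impI)
  fix \<alpha>s :: "'a set set list" and a
  assume "\<alpha>s \<in> families" "a \<in> quot_space (bracket \<alpha>s)"
  then show "character_on (asymp_algebra :: ('a \<Rightarrow> complex) set) (\<lambda>u. quot_eval (tau_family \<alpha>s u) a)"
    unfolding asymp_algebra_eq tau_family_def
    by (intro character_tau_from[OF assms subspace_single_0]) (auto simp: families_def bracket_def)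
next
  fix \<phi> assume \<phi>: "character_on (asymp_algebra :: ('a \<Rightarrow> complex) set) \<phi>"
  obtain F where F: "F \<noteq> bot" "\<And>u. u \<in> quot_algebra {0::'a} \<Longrightarrow> (u \<longlongrightarrow> \<phi> u) F"
    using character_limit_of_evaluations[OF cstar_subalgebra_quot_algebra[OF assms] const_in_quot_algebra
      \<phi>[unfolded asymp_algebra_eq]] by blast
  obtain \<alpha>s c F' where *: "is_family_from {0::'a} \<alpha>s" "c \<in> quot_space (bracket_from {0} \<alpha>s)" "F' \<le> F" "F' \<noteq> bot"
      "\<And>u. u \<in> quot_algebra {0} \<Longrightarrow> (u \<longlongrightarrow> quot_eval (tau_from {0} \<alpha>s u) c) F'"
    using filter_converging_to_composed_character[OF assms subspace_single_0 F(1)] by blast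
  have "\<alpha>s \<in> families"
    using *(1) is_family_from_length[OF assms subspace_single_0 *(1)] by (simp add: families_def)
  moreover have "c \<in> quot_space (bracket \<alpha>s)" using *(2) by (simp add: bracket_def)
  moreover have "\<phi> u = quot_eval (tau_family \<alpha>s u) c" if "u \<in> asymp_algebra" for u
    using tendsto_unique[OF *(4) tendsto_mono[OF *(3) F(2)] *(5), of u] that
    unfolding asymp_algebra_eq tau_family_def by blast
  ultimately show "\<exists>\<alpha>s\<in>families. \<exists>a\<in>quot_space (bracket \<alpha>s). \<forall>u\<in>asymp_algebra. \<phi> u = quot_eval (tau_family \<alpha>s u) a"
    by blast
qed

end
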